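(* Let $R$ be a unital associative algebra over a commutative ring $\mathfrak k$, let $x_1,\dots,x_n\in R$ with $n\ge2$, and let $\imath\colon R\to L(R)$ be the Leavitt localization of $R$ inverting universally the row $(x_1,\dots,x_n)$. Then: (1) The right $\imath(R)$-module $\sum_{i=1}^n\imath(x_i)\imath(R)$ is free of rank $n$ on $\imath(x_1),\dots,\imath(x_n)$ and has trivial left annihilator in $\imath(R)$. Hence, if $\imath$ is one-to-one, then $\sum_{i=1}^n x_iR=\bigoplus_{i=1}^n x_iR$ is a free right $R$-module of rank $n$ on the $x_i$ with trivial left annihilator. (2) Conversely, suppose $I=\sum_{i=1}^nx_iR$ is a two-sided ideal of $R$ which is a free right $R$-module of rank $n$ on the $x_i$ and has trivial left annihilator, and let $Q(R)$ be the ring of right quotients of $R$ with respect to the $I$-adic topology (which is a Gabriel topology). Then the induced homomorphism $f\colon L(R)\to Q(R)$ is an isomorphism, whence $\imath\colon R\to L(R)$ is one-to-one.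
   Context: $L(R)$ is the $\mathfrak k$-algebra generated over $R$ by elements $x_1^*,\dots,x_n^*$ subject to the relations $x_i^*x_j=\delta_{ij}$ ($1\le i,j\le n$) and $\sum_{i=1}^nx_ix_i^*=1$; $\imath\colon R\to L(R)$ is the canonical map. A right ideal $I$ has trivial left annihilator in $R$ if $rI=0$, $r\in R$, implies $r=0$. Under the assumptions of (2), $Q(R)=\varinjlim_{l}\operatorname{Hom}_R(I^l_R,R_R)$ (with the usual multiplication by composition of partial homomorphisms); it contains $R$ (acting by left multiplication), and $x_i^\star\in\operatorname{Hom}_R(I,R)\subseteq Q(R)$ is defined by $x_i^\star(x_j)=\delta_{ij}$. The column of the $x_i^\star$ is inverse to the row $(x_1,\dots,x_n)$ over $Q(R)$, and $f\colon L(R)\to Q(R)$ is the algebra homomorphism compatible with the canonical maps from $R$ and sending $x_i^*\mapsto x_i^\star$. *)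

theory Defs
  imports "HOL-Algebra.Module" "HOL-Algebra.Ideal_Product"
begin

section \<open>Unital associative algebras\<close>

text \<open>The library's \<open>algebra\<close> locale is restricted to commutative algebras, hence this variant.
  The zero algebra is allowed.\<close>

locale assoc_algebra = module K A + ring A for K (structure) and A (structure) +
  assumes smult_mult_left:
      "\<lbrakk>c \<in> carrier K; a \<in> carrier A; b \<in> carrier A\<rbrakk>
        \<Longrightarrow> (c \<odot>\<^bsub>A\<^esub> a) \<otimes>\<^bsub>A\<^esub> b = c \<odot>\<^bsub>A\<^esub> (a \<otimes>\<^bsub>A\<^esub> b)"
    and smult_mult_right:
      "\<lbrakk>c \<in> carrier K; a \<in> carrier A; b \<in> carrier A\<rbrakk>
        \<Longrightarrow> a \<otimes>\<^bsub>A\<^esub> (c \<odot>\<^bsub>A\<^esub> b) = c \<odot>\<^bsub>A\<^esub> (a \<otimes>\<^bsub>A\<^esub> b)"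

definition alg_hom ::
    "('k, 's) ring_scheme \<Rightarrow> ('k, 'a, 't) module_scheme \<Rightarrow> ('k, 'b, 'u) module_scheme \<Rightarrow> ('a \<Rightarrow> 'b) set"
  where "alg_hom K A B =
    {h \<in> ring_hom A B. \<forall>c\<in>carrier K. \<forall>a\<in>carrier A. h (c \<odot>\<^bsub>A\<^esub> a) = c \<odot>\<^bsub>B\<^esub> h a}"

definition alg_iso ::
    "('k, 's) ring_scheme \<Rightarrow> ('k, 'a, 't) module_scheme \<Rightarrow> ('k, 'b, 'u) module_scheme \<Rightarrow> ('a \<Rightarrow> 'b) set"
  where "alg_iso K A B = {h \<in> alg_hom K A B. bij_betw h (carrier A) (carrier B)}"


section \<open>Right modules spanned by a row of ring elements\<close>

definition right_comb :: "('a, 's) ring_scheme \<Rightarrow> nat \<Rightarrow> (nat \<Rightarrow> 'a) \<Rightarrow> (nat \<Rightarrow> 'a) \<Rightarrow> 'a"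
  where "right_comb S n y s = (\<Oplus>\<^bsub>S\<^esub>i\<in>{1..n}. y i \<otimes>\<^bsub>S\<^esub> s i)"

definition right_span :: "('a, 's) ring_scheme \<Rightarrow> nat \<Rightarrow> (nat \<Rightarrow> 'a) \<Rightarrow> 'a set"
  where "right_span S n y = right_comb S n y ` ({1..n} \<rightarrow>\<^sub>E carrier S)"

text \<open>Freeness refers to the indexed family \<open>y 1, \<dots>, y n\<close>: the map from \<open>S\<^sup>n\<close> to \<open>M\<close> sending
  coefficients to the corresponding right linear combination is bijective.\<close>

definition free_right_module_on :: "('a, 's) ring_scheme \<Rightarrow> nat \<Rightarrow> (nat \<Rightarrow> 'a) \<Rightarrow> 'a set \<Rightarrow> bool"
  where "free_right_module_on S n y M \<longleftrightarrow>
    bij_betw (right_comb S n y) ({1..n} \<rightarrow>\<^sub>E carrier S) M"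

definition internal_direct_sum :: "('a, 's) ring_scheme \<Rightarrow> nat \<Rightarrow> (nat \<Rightarrow> 'a set) \<Rightarrow> 'a set \<Rightarrow> bool"
  where "internal_direct_sum S n N M \<longleftrightarrow>
    bij_betw (\<lambda>m. \<Oplus>\<^bsub>S\<^esub>i\<in>{1..n}. m i) (\<Pi>\<^sub>E i\<in>{1..n}. N i) M"

definition trivial_left_annihilator :: "('a, 's) ring_scheme \<Rightarrow> 'a set \<Rightarrow> bool"
  where "trivial_left_annihilator S M \<longleftrightarrow>
    (\<forall>r\<in>carrier S. (\<forall>a\<in>M. r \<otimes>\<^bsub>S\<^esub> a = \<zero>\<^bsub>S\<^esub>) \<longrightarrow> r = \<zero>\<^bsub>S\<^esub>)"


section \<open>The Leavitt localization\<close>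

text \<open>The algebra \<open>L(R)\<close> is constructed from its presentation: formal algebra expressions in the
  elements of \<open>R\<close> and the symbols \<open>x\<^sub>i\<^sup>*\<close> (written \<open>Star i\<close>), modulo the smallest congruence
  that enforces the axioms of a unital associative \<open>K\<close>-algebra, makes \<open>Base\<close> a unital
  \<open>K\<close>-algebra homomorphism and satisfies the defining relations. Zero and one are \<open>Base \<zero>\<close>
  and \<open>Base \<one>\<close>.\<close>

datatype ('k, 'a) leavitt_term =
    Base 'a
  | Star nat
  | Plus "('k, 'a) leavitt_term" "('k, 'a) leavitt_term"
  | Times "('k, 'a) leavitt_term" "('k, 'a) leavitt_term"
  | Minus "('k, 'a) leavitt_term"
  | Scale 'k "('k, 'a) leavitt_term"

primrec wf_term ::
    "('k, 's) ring_scheme \<Rightarrow> ('k, 'a, 't) module_scheme \<Rightarrow> nat \<Rightarrow> ('k, 'a) leavitt_term \<Rightarrow> bool"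
  where
    "wf_term K R n (Base a) \<longleftrightarrow> a \<in> carrier R"
  | "wf_term K R n (Star i) \<longleftrightarrow> i \<in> {1..n}"
  | "wf_term K R n (Plus s t) \<longleftrightarrow> wf_term K R n s \<and> wf_term K R n t"
  | "wf_term K R n (Times s t) \<longleftrightarrow> wf_term K R n s \<and> wf_term K R n t"
  | "wf_term K R n (Minus s) \<longleftrightarrow> wf_term K R n s"
  | "wf_term K R n (Scale c s) \<longleftrightarrow> c \<in> carrier K \<and> wf_term K R n s"

inductive leavitt_eq ::
    "('k, 's) ring_scheme \<Rightarrow> ('k, 'a, 't) module_scheme \<Rightarrow> nat \<Rightarrow> (nat \<Rightarrow> 'a)
      \<Rightarrow> ('k, 'a) leavitt_term \<Rightarrow> ('k, 'a) leavitt_term \<Rightarrow> bool"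
  for K :: "('k, 's) ring_scheme" and R :: "('k, 'a, 't) module_scheme"
    and n :: nat and x :: "nat \<Rightarrow> 'a"
  where
    le_refl: "wf_term K R n s \<Longrightarrow> leavitt_eq K R n x s s"
  | le_sym: "leavitt_eq K R n x s t \<Longrightarrow> leavitt_eq K R n x t s"
  | le_trans: "leavitt_eq K R n x s t \<Longrightarrow> leavitt_eq K R n x t u \<Longrightarrow> leavitt_eq K R n x s u"
  | le_Plus: "leavitt_eq K R n x s s' \<Longrightarrow> leavitt_eq K R n x t t'
      \<Longrightarrow> leavitt_eq K R n x (Plus s t) (Plus s' t')"
  | le_Times: "leavitt_eq K R n x s s' \<Longrightarrow> leavitt_eq K R n x t t'
      \<Longrightarrow> leavitt_eq K R n x (Times s t) (Times s' t')"
  | le_Minus: "leavitt_eq K R n x s s' \<Longrightarrow> leavitt_eq K R n x (Minus s) (Minus s')"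
  | le_Scale: "c \<in> carrier K \<Longrightarrow> leavitt_eq K R n x s s'
      \<Longrightarrow> leavitt_eq K R n x (Scale c s) (Scale c s')"
  \<comment> \<open>unital ring axioms\<close>
  | le_add_assoc: "wf_term K R n s \<Longrightarrow> wf_term K R n t \<Longrightarrow> wf_term K R n u
      \<Longrightarrow> leavitt_eq K R n x (Plus (Plus s t) u) (Plus s (Plus t u))"
  | le_add_comm: "wf_term K R n s \<Longrightarrow> wf_term K R n t
      \<Longrightarrow> leavitt_eq K R n x (Plus s t) (Plus t s)"
  | le_add_zero: "wf_term K R n s \<Longrightarrow> leavitt_eq K R n x (Plus (Base \<zero>\<^bsub>R\<^esub>) s) s"
  | le_add_minus: "wf_term K R n s \<Longrightarrow> leavitt_eq K R n x (Plus (Minus s) s) (Base \<zero>\<^bsub>R\<^esub>)"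
  | le_mult_assoc: "wf_term K R n s \<Longrightarrow> wf_term K R n t \<Longrightarrow> wf_term K R n u
      \<Longrightarrow> leavitt_eq K R n x (Times (Times s t) u) (Times s (Times t u))"
  | le_one_left: "wf_term K R n s \<Longrightarrow> leavitt_eq K R n x (Times (Base \<one>\<^bsub>R\<^esub>) s) s"
  | le_one_right: "wf_term K R n s \<Longrightarrow> leavitt_eq K R n x (Times s (Base \<one>\<^bsub>R\<^esub>)) s"
  | le_distrib_left: "wf_term K R n s \<Longrightarrow> wf_term K R n t \<Longrightarrow> wf_term K R n u
      \<Longrightarrow> leavitt_eq K R n x (Times s (Plus t u)) (Plus (Times s t) (Times s u))"
  | le_distrib_right: "wf_term K R n s \<Longrightarrow> wf_term K R n t \<Longrightarrow> wf_term K R n u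
      \<Longrightarrow> leavitt_eq K R n x (Times (Plus s t) u) (Plus (Times s u) (Times t u))"
  \<comment> \<open>\<open>K\<close>-algebra axioms\<close>
  | le_scale_add_scalar: "c \<in> carrier K \<Longrightarrow> d \<in> carrier K \<Longrightarrow> wf_term K R n s
      \<Longrightarrow> leavitt_eq K R n x (Scale (c \<oplus>\<^bsub>K\<^esub> d) s) (Plus (Scale c s) (Scale d s))"
  | le_scale_add: "c \<in> carrier K \<Longrightarrow> wf_term K R n s \<Longrightarrow> wf_term K R n t
      \<Longrightarrow> leavitt_eq K R n x (Scale c (Plus s t)) (Plus (Scale c s) (Scale c t))"
  | le_scale_mult_scalar: "c \<in> carrier K \<Longrightarrow> d \<in> carrier K \<Longrightarrow> wf_term K R n s
      \<Longrightarrow> leavitt_eq K R n x (Scale (c \<otimes>\<^bsub>K\<^esub> d) s) (Scale c (Scale d s))"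
  | le_scale_one: "wf_term K R n s \<Longrightarrow> leavitt_eq K R n x (Scale \<one>\<^bsub>K\<^esub> s) s"
  | le_scale_left: "c \<in> carrier K \<Longrightarrow> wf_term K R n s \<Longrightarrow> wf_term K R n t
      \<Longrightarrow> leavitt_eq K R n x (Times (Scale c s) t) (Scale c (Times s t))"
  | le_scale_right: "c \<in> carrier K \<Longrightarrow> wf_term K R n s \<Longrightarrow> wf_term K R n t
      \<Longrightarrow> leavitt_eq K R n x (Times s (Scale c t)) (Scale c (Times s t))"
  \<comment> \<open>\<open>Base\<close> is an algebra homomorphism\<close>
  | le_base_add: "a \<in> carrier R \<Longrightarrow> b \<in> carrier R
      \<Longrightarrow> leavitt_eq K R n x (Base (a \<oplus>\<^bsub>R\<^esub> b)) (Plus (Base a) (Base b))"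
  | le_base_mult: "a \<in> carrier R \<Longrightarrow> b \<in> carrier R
      \<Longrightarrow> leavitt_eq K R n x (Base (a \<otimes>\<^bsub>R\<^esub> b)) (Times (Base a) (Base b))"
  | le_base_smult: "c \<in> carrier K \<Longrightarrow> a \<in> carrier R
      \<Longrightarrow> leavitt_eq K R n x (Base (c \<odot>\<^bsub>R\<^esub> a)) (Scale c (Base a))"
  \<comment> \<open>\<open>x\<^sub>i\<^sup>* x\<^sub>j = \<delta>\<^sub>i\<^sub>j\<close> and \<open>\<Sum>\<^sub>i x\<^sub>i x\<^sub>i\<^sup>* = 1\<close>\<close>
  | le_star_base: "i \<in> {1..n} \<Longrightarrow> j \<in> {1..n}
      \<Longrightarrow> leavitt_eq K R n x (Times (Star i) (Base (x j)))
            (Base (if i = j then \<one>\<^bsub>R\<^esub> else \<zero>\<^bsub>R\<^esub>))"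
  | le_sum_star: "leavitt_eq K R n x
      (foldr Plus (map (\<lambda>i. Times (Base (x i)) (Star i)) [1..<Suc n]) (Base \<zero>\<^bsub>R\<^esub>))
      (Base \<one>\<^bsub>R\<^esub>)"

definition leavitt_class ::
    "('k, 's) ring_scheme \<Rightarrow> ('k, 'a, 't) module_scheme \<Rightarrow> nat \<Rightarrow> (nat \<Rightarrow> 'a)
      \<Rightarrow> ('k, 'a) leavitt_term \<Rightarrow> ('k, 'a) leavitt_term set"
  where "leavitt_class K R n x s = {t. leavitt_eq K R n x s t}"

definition leavitt_algebra ::
    "('k, 's) ring_scheme \<Rightarrow> ('k, 'a, 't) module_scheme \<Rightarrow> nat \<Rightarrow> (nat \<Rightarrow> 'a)
      \<Rightarrow> ('k, ('k, 'a) leavitt_term set) module"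
  where "leavitt_algebra K R n x =
    \<lparr> carrier = leavitt_class K R n x ` {s. wf_term K R n s},
      mult = (\<lambda>A B. \<Union>s\<in>A. \<Union>t\<in>B. leavitt_class K R n x (Times s t)),
      one = leavitt_class K R n x (Base \<one>\<^bsub>R\<^esub>),
      zero = leavitt_class K R n x (Base \<zero>\<^bsub>R\<^esub>),
      add = (\<lambda>A B. \<Union>s\<in>A. \<Union>t\<in>B. leavitt_class K R n x (Plus s t)),
      smult = (\<lambda>c A. \<Union>s\<in>A. leavitt_class K R n x (Scale c s)) \<rparr>"

definition leavitt_map ::
    "('k, 's) ring_scheme \<Rightarrow> ('k, 'a, 't) module_scheme \<Rightarrow> nat \<Rightarrow> (nat \<Rightarrow> 'a)
      \<Rightarrow> 'a \<Rightarrow> ('k, 'a) leavitt_term set"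
  where "leavitt_map K R n x a = leavitt_class K R n x (Base a)"

definition leavitt_star ::
    "('k, 's) ring_scheme \<Rightarrow> ('k, 'a, 't) module_scheme \<Rightarrow> nat \<Rightarrow> (nat \<Rightarrow> 'a)
      \<Rightarrow> nat \<Rightarrow> ('k, 'a) leavitt_term set"
  where "leavitt_star K R n x i = leavitt_class K R n x (Star i)"

text \<open>The image \<open>\<imath>(R)\<close> as a subring of \<open>L(R)\<close>.\<close>

definition leavitt_image ::
    "('k, 's) ring_scheme \<Rightarrow> ('k, 'a, 't) module_scheme \<Rightarrow> nat \<Rightarrow> (nat \<Rightarrow> 'a)
      \<Rightarrow> ('k, ('k, 'a) leavitt_term set) module"
  where "leavitt_image K R n x =
    (leavitt_algebra K R n x) \<lparr>carrier := leavitt_map K R n x ` carrier R\<rparr>"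


section \<open>Gabriel topologies\<close>

definition right_ideal :: "'a set \<Rightarrow> ('a, 's) ring_scheme \<Rightarrow> bool"
  where "right_ideal J R \<longleftrightarrow>
    additive_subgroup J R \<and> (\<forall>a\<in>J. \<forall>r\<in>carrier R. a \<otimes>\<^bsub>R\<^esub> r \<in> J)"

definition colon :: "('a, 's) ring_scheme \<Rightarrow> 'a set \<Rightarrow> 'a \<Rightarrow> 'a set"
  where "colon R J a = {r \<in> carrier R. a \<otimes>\<^bsub>R\<^esub> r \<in> J}"

definition gabriel_topology :: "('a, 's) ring_scheme \<Rightarrow> 'a set set \<Rightarrow> bool"
  where "gabriel_topology R F \<longleftrightarrow>
    F \<noteq> {} \<and> (\<forall>J\<in>F. right_ideal J R) \<and>
    (\<forall>J J'. J \<in> F \<longrightarrow> right_ideal J' R \<longrightarrow> J \<subseteq> J' \<longrightarrow> J' \<in> F) \<and>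
    (\<forall>J\<in>F. \<forall>J'\<in>F. J \<inter> J' \<in> F) \<and>
    (\<forall>J\<in>F. \<forall>a\<in>carrier R. colon R J a \<in> F) \<and>
    (\<forall>J. right_ideal J R \<longrightarrow> (\<exists>J'\<in>F. \<forall>a\<in>J'. colon R J a \<in> F) \<longrightarrow> J \<in> F)"

text \<open>Powers of ideals are the library's, so \<open>I\<^sup>0 = R\<close>.\<close>

abbreviation ideal_pow :: "('a, 's) ring_scheme \<Rightarrow> 'a set \<Rightarrow> nat \<Rightarrow> 'a set"
  where "ideal_pow R I l \<equiv> I [^]\<^bsub>ideals_set R\<^esub> l"

definition adic_topology :: "('a, 's) ring_scheme \<Rightarrow> 'a set \<Rightarrow> 'a set set"
  where "adic_topology R I = {J. right_ideal J R \<and> (\<exists>l. ideal_pow R I l \<subseteq> J)}"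


section \<open>The ring of right quotients for the adic topology of an ideal\<close>

definition right_module_hom :: "('a, 's) ring_scheme \<Rightarrow> 'a set \<Rightarrow> ('a \<Rightarrow> 'a) set"
  where "right_module_hom R J =
    {\<phi> \<in> J \<rightarrow>\<^sub>E carrier R.
       (\<forall>a\<in>J. \<forall>b\<in>J. \<phi> (a \<oplus>\<^bsub>R\<^esub> b) = \<phi> a \<oplus>\<^bsub>R\<^esub> \<phi> b) \<and>
       (\<forall>a\<in>J. \<forall>r\<in>carrier R. \<phi> (a \<otimes>\<^bsub>R\<^esub> r) = \<phi> a \<otimes>\<^bsub>R\<^esub> r)}"

text \<open>The direct limit of the \<open>Hom\<^sub>R(I\<^sup>l, R)\<close> along restriction: pairs \<open>(l, \<phi>)\<close>, identified when they
  agree on some common smaller power.\<close>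

definition partial_homs :: "('a, 's) ring_scheme \<Rightarrow> 'a set \<Rightarrow> (nat \<times> ('a \<Rightarrow> 'a)) set"
  where "partial_homs R I = (SIGMA l:UNIV. right_module_hom R (ideal_pow R I l))"

definition quot_rel ::
    "('a, 's) ring_scheme \<Rightarrow> 'a set \<Rightarrow> ((nat \<times> ('a \<Rightarrow> 'a)) \<times> (nat \<times> ('a \<Rightarrow> 'a))) set"
  where "quot_rel R I = {((l, \<phi>), (m, \<psi>)). (l, \<phi>) \<in> partial_homs R I \<and> (m, \<psi>) \<in> partial_homs R I \<and>
    (\<exists>p. l \<le> p \<and> m \<le> p \<and> (\<forall>a\<in>ideal_pow R I p. \<phi> a = \<psi> a))}"

definition quot_class ::
    "('a, 's) ring_scheme \<Rightarrow> 'a set \<Rightarrow> nat \<Rightarrow> ('a \<Rightarrow> 'a) \<Rightarrow> (nat \<times> ('a \<Rightarrow> 'a)) set"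
  where "quot_class R I l f = quot_rel R I `` {(l, restrict f (ideal_pow R I l))}"

text \<open>Multiplication is composition of partial homomorphisms: since \<open>\<psi>\<close> maps \<open>I\<^sup>l\<^sup>+\<^sup>m = I\<^sup>m I\<^sup>l\<close> into
  \<open>I\<^sup>l\<close>, the composite of \<open>(l, \<phi>)\<close> and \<open>(m, \<psi>)\<close> is defined on \<open>I\<^sup>l\<^sup>+\<^sup>m\<close>.\<close>

definition quotient_algebra ::
    "('k, 'a, 't) module_scheme \<Rightarrow> 'a set \<Rightarrow> ('k, (nat \<times> ('a \<Rightarrow> 'a)) set) module"
  where "quotient_algebra R I =
    \<lparr> carrier = partial_homs R I // quot_rel R I,
      mult = (\<lambda>A B. \<Union>(l, \<phi>)\<in>A. \<Union>(m, \<psi>)\<in>B. quot_class R I (l + m) (\<lambda>a. \<phi> (\<psi> a))),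
      one = quot_class R I 0 (\<lambda>a. a),
      zero = quot_class R I 0 (\<lambda>a. \<zero>\<^bsub>R\<^esub>),
      add = (\<lambda>A B. \<Union>(l, \<phi>)\<in>A. \<Union>(m, \<psi>)\<in>B. quot_class R I (max l m) (\<lambda>a. \<phi> a \<oplus>\<^bsub>R\<^esub> \<psi> a)),
      smult = (\<lambda>c A. \<Union>(l, \<phi>)\<in>A. quot_class R I l (\<lambda>a. c \<odot>\<^bsub>R\<^esub> \<phi> a)) \<rparr>"

definition quotient_map :: "('a, 's) ring_scheme \<Rightarrow> 'a set \<Rightarrow> 'a \<Rightarrow> (nat \<times> ('a \<Rightarrow> 'a)) set"
  where "quotient_map R I r = quot_class R I 0 (\<lambda>a. r \<otimes>\<^bsub>R\<^esub> a)"

text \<open>The dual basis element \<open>x\<^sub>i\<^sup>\<star> \<in> Hom\<^sub>R(I, R)\<close>, unique when \<open>I\<close> is free on the \<open>x\<^sub>j\<close>.\<close>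

definition dual_hom ::
    "('a, 's) ring_scheme \<Rightarrow> nat \<Rightarrow> (nat \<Rightarrow> 'a) \<Rightarrow> nat \<Rightarrow> 'a \<Rightarrow> 'a"
  where "dual_hom R n x i = (THE \<phi>. \<phi> \<in> right_module_hom R (right_span R n x) \<and>
    (\<forall>j\<in>{1..n}. \<phi> (x j) = (if i = j then \<one>\<^bsub>R\<^esub> else \<zero>\<^bsub>R\<^esub>)))"

definition quotient_star ::
    "('a, 's) ring_scheme \<Rightarrow> nat \<Rightarrow> (nat \<Rightarrow> 'a) \<Rightarrow> nat \<Rightarrow> (nat \<times> ('a \<Rightarrow> 'a)) set"
  where "quotient_star R n x i = quot_class R (right_span R n x) 1 (dual_hom R n x i)"

text \<open>The algebra homomorphisms \<open>L(R) \<rightarrow> Q(R)\<close> compatible with the canonical maps from \<open>R\<close> and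
  sending \<open>x\<^sub>i\<^sup>*\<close> to \<open>x\<^sub>i\<^sup>\<star>\<close>; as functions they are taken undefined outside \<open>L(R)\<close>, so that
  the induced homomorphism is unique in HOL.\<close>

definition induced_homs ::
    "('k, 's) ring_scheme \<Rightarrow> ('k, 'a, 't) module_scheme \<Rightarrow> nat \<Rightarrow> (nat \<Rightarrow> 'a)
      \<Rightarrow> (('k, 'a) leavitt_term set \<Rightarrow> (nat \<times> ('a \<Rightarrow> 'a)) set) set"
  where "induced_homs K R n x =
    {f \<in> alg_hom K (leavitt_algebra K R n x) (quotient_algebra R (right_span R n x)).
       f \<in> extensional (carrier (leavitt_algebra K R n x)) \<and>
       (\<forall>r\<in>carrier R. f (leavitt_map K R n x r) = quotient_map R (right_span R n x) r) \<and>
       (\<forall>i\<in>{1..n}. f (leavitt_star K R n x i) = quotient_star R n x i)}"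

end

theory Submission
  imports Defs "HOL-Algebra.QuotRing"
begin

text \<open>Part (1): over \<open>L(R)\<close> the column of the \<open>x\<^sub>i\<^sup>*\<close> is a two-sided inverse of the row of the
  \<open>x\<^sub>i\<close>. Multiplying \<open>\<Sum>\<^sub>i x\<^sub>i r\<^sub>i\<close> on the left by \<open>x\<^sub>j\<^sup>*\<close> recovers \<open>r\<^sub>j\<close>, and if \<open>r x\<^sub>i = 0\<close> for all
  \<open>i\<close>, then \<open>r = \<Sum>\<^sub>i r x\<^sub>i x\<^sub>i\<^sup>* = 0\<close>.

  Part (2): the universal property of \<open>L(R)\<close> gives \<open>f\<close>, because \<open>Q(R)\<close> contains an inverse column
  as well. Surjectivity goes by induction on \<open>l\<close>: the class \<open>q\<close> of a homomorphism \<open>I\<^sup>l\<^sup>+\<^sup>1 \<rightarrow> R\<close>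
  satisfies \<open>q = \<Sum>\<^sub>i (q x\<^sub>i) x\<^sub>i\<^sup>\<star>\<close>, and \<open>q x\<^sub>i\<close> is already defined on \<open>I\<^sup>l\<close>. For injectivity, let
  \<open>f y = 0\<close> with \<open>y \<imath>(I\<^sup>l) \<subseteq> \<imath>(R)\<close>. If \<open>l = 0\<close> then \<open>y = \<imath>(r)\<close> with \<open>r\<close> annihilating a power of
  \<open>I\<close>, so \<open>r = 0\<close>; otherwise \<open>y x\<^sub>i\<close> satisfies the hypothesis for \<open>l - 1\<close>, so all \<open>y x\<^sub>i\<close> vanish
  and \<open>y = \<Sum>\<^sub>i y x\<^sub>i x\<^sub>i\<^sup>* = 0\<close>. The same induction, with \<open>(J : x\<^sub>i)\<close> in place of \<open>J\<close>, proves the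
  last axiom of a Gabriel topology.\<close>


section \<open>Rows with an inverse column\<close>

text \<open>Distributing \<open>z j\<close> over the sum, the duality relations kill every summand
  except the one with index \<open>j\<close>. Coefficients can thus be read off from a right
  combination, which is what gives independence of the row.\<close>

lemma (in ring) dual_row_coeff:
  assumes y: "y \<in> {1..n} \<rightarrow> carrier R" and z: "z \<in> {1..n} \<rightarrow> carrier R"
    and dual: "\<And>i j. i \<in> {1..n} \<Longrightarrow> j \<in> {1..n} \<Longrightarrow> z i \<otimes> y j = (if i = j then \<one> else \<zero>)"
    and s: "s \<in> {1..n} \<rightarrow> carrier R" and j: "j \<in> {1..n}"
  shows "z j \<otimes> right_comb R n y s = s j"
proof -
  have "z j \<otimes> right_comb R n y s = (\<Oplus>i\<in>{1..n}. z j \<otimes> (y i \<otimes> s i))"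
    unfolding right_comb_def using y z s j by (intro finsum_rdistr) auto
  also have "\<dots> = (\<Oplus>i\<in>{1..n}. if j = i then s i else \<zero>)"
  proof (rule finsum_cong')
    fix i assume i: "i \<in> {1..n}"
    have "z j \<otimes> (y i \<otimes> s i) = (z j \<otimes> y i) \<otimes> s i"
      using y z s i j by (intro m_assoc[symmetric]) auto
    then show "z j \<otimes> (y i \<otimes> s i) = (if j = i then s i else \<zero>)"
      using dual[OF j i] s i by (auto simp: Pi_iff)
  qed (use s in auto)
  also have "\<dots> = s j"
    using s j by (intro finsum_singleton) auto
  finally show ?thesis .
qed

text \<open>Write \<open>a\<close> as \<open>a\<close> times \<open>1\<close> and replace
  \<open>1\<close> by the sum of the \<open>y i \<otimes> z i\<close>. In \<open>L\<close> this
  serves to detect zero, in \<open>Q\<close> to build preimages.\<close>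

lemma (in ring) dual_row_expand:
  assumes fin: "finite A" and y: "y \<in> A \<rightarrow> carrier R" and z: "z \<in> A \<rightarrow> carrier R"
    and sum: "(\<Oplus>i\<in>A. y i \<otimes> z i) = \<one>" and a: "a \<in> carrier R"
  shows "a = (\<Oplus>i\<in>A. (a \<otimes> y i) \<otimes> z i)"
proof -
  have "a = a \<otimes> (\<Oplus>i\<in>A. y i \<otimes> z i)" using sum a by simp
  also have "\<dots> = (\<Oplus>i\<in>A. a \<otimes> (y i \<otimes> z i))"
    using fin y z a by (intro finsum_rdistr) auto
  also have "\<dots> = (\<Oplus>i\<in>A. (a \<otimes> y i) \<otimes> z i)"
    using y z a by (intro finsum_cong') (auto simp: m_assoc Pi_iff)
  finally show ?thesis .
qed

lemma (in ring) dual_row_annihilator: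
  assumes fin: "finite A" and y: "y \<in> A \<rightarrow> carrier R" and z: "z \<in> A \<rightarrow> carrier R"
    and sum: "(\<Oplus>i\<in>A. y i \<otimes> z i) = \<one>" and a: "a \<in> carrier R"
    and zero: "\<And>i. i \<in> A \<Longrightarrow> a \<otimes> y i = \<zero>"
  shows "a = \<zero>"
proof -
  have "a = (\<Oplus>i\<in>A. (a \<otimes> y i) \<otimes> z i)" by (rule dual_row_expand[OF fin y z sum a])
  also have "\<dots> = (\<Oplus>i\<in>A. \<zero>)"
    using z zero by (intro finsum_cong') (auto simp: Pi_iff)
  finally show ?thesis by simp
qed

text \<open>Passing to the image of \<open>R\<close> changes only the carrier of the record, but
  \<open>finsum\<close> depends on the whole record, so the two sums have to be compared by
  induction.\<close>

lemma finsum_subring: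
  assumes "ring R" "ring (R\<lparr>carrier := H\<rparr>)" "H \<subseteq> carrier R" "finite A" "f \<in> A \<rightarrow> H"
  shows "finsum (R\<lparr>carrier := H\<rparr>) f A = finsum R f A"
proof -
  interpret R: ring R by fact
  interpret S: ring "R\<lparr>carrier := H\<rparr>" by fact
  show ?thesis using assms(4,5)
  proof (induction rule: finite_induct)
    case empty
    show ?case by simp
  next
    case (insert a F)
    have "finsum (R\<lparr>carrier := H\<rparr>) f (insert a F) = f a \<oplus>\<^bsub>R\<^esub> finsum (R\<lparr>carrier := H\<rparr>) f F"
      using insert by (subst S.finsum_insert) auto
    also have "\<dots> = finsum R f (insert a F)"
      using insert assms(3) by (subst R.finsum_insert) auto
    finally show ?case .
  qed
qed

lemma ring_hom_finsum:
  assumes "ring R" "ring S" "h \<in> ring_hom R S" "finite A" "f \<in> A \<rightarrow> carrier R"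
  shows "h (finsum R f A) = (\<Oplus>\<^bsub>S\<^esub>i\<in>A. h (f i))"
proof -
  interpret ring_hom_ring R S h using assms by (simp add: ring_hom_ringI2)
  show ?thesis using assms(4,5)
  proof (induction rule: finite_induct)
    case (insert a F)
    then show ?case
      by (subst R.finsum_insert) (auto simp: S.finsum_insert Pi_iff)
  qed simp
qed

section \<open>Right spans, freeness and direct sums\<close>

lemma right_comb_restrict:
  assumes "ring R" "y \<in> {1..n} \<rightarrow> carrier R" "s \<in> {1..n} \<rightarrow> carrier R"
  shows "right_comb R n y (restrict s {1..n}) = right_comb R n y s"
proof -
  interpret ring R by fact
  show ?thesis unfolding right_comb_def using assms(2,3) by (intro finsum_cong') auto
qed

lemma right_span_iff:
  assumes "ring R" "y \<in> {1..n} \<rightarrow> carrier R"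
  shows "a \<in> right_span R n y \<longleftrightarrow> (\<exists>s \<in> {1..n} \<rightarrow> carrier R. a = right_comb R n y s)"
proof
  assume "\<exists>s \<in> {1..n} \<rightarrow> carrier R. a = right_comb R n y s"
  then obtain s where "s \<in> {1..n} \<rightarrow> carrier R" "a = right_comb R n y s" by blast
  then show "a \<in> right_span R n y"
    unfolding right_span_def using right_comb_restrict[OF assms, of s]
    by (intro image_eqI[of _ _ "restrict s {1..n}"]) auto
qed (auto simp: right_span_def PiE_def)

lemma (in ring) mem_right_span:
  assumes y: "y \<in> {1..n} \<rightarrow> carrier R" and i: "i \<in> {1..n}"
  shows "y i \<in> right_span R n y"
proof -
  have "right_comb R n y (\<lambda>j. if i = j then \<one> else \<zero>) = (\<Oplus>j\<in>{1..n}. if i = j then y j else \<zero>)"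
    unfolding right_comb_def using y by (intro finsum_cong') (auto simp: Pi_iff)
  also have "\<dots> = y i" using y i by (intro finsum_singleton) auto
  finally show ?thesis
    unfolding right_span_iff[OF ring_axioms y]
    by (intro bexI[of _ "\<lambda>j. if i = j then \<one> else \<zero>"]) auto
qed

text \<open>The span is the image of the coefficient map by definition, so only injectivity is at
  stake, and a left inverse suffices. The \<open>z j\<close> may be arbitrary functions: below they
  are a multiplication in a larger ring, or such a multiplication followed by an inverse of
  \<open>\<iota>\<close>.\<close>

lemma (in ring) free_right_module_onI:
  assumes y: "y \<in> {1..n} \<rightarrow> carrier R"
    and ker: "\<And>s j. s \<in> {1..n} \<rightarrow> carrier R \<Longrightarrow> j \<in> {1..n} \<Longrightarrow> z j (right_comb R n y s) = s j"
  shows "free_right_module_on R n y (right_span R n y)"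
  unfolding free_right_module_on_def right_span_def
proof (rule inj_on_imp_bij_betw, rule inj_onI)
  fix s t assume st: "s \<in> {1..n} \<rightarrow>\<^sub>E carrier R" "t \<in> {1..n} \<rightarrow>\<^sub>E carrier R"
    and eq: "right_comb R n y s = right_comb R n y t"
  show "s = t"
  proof (rule PiE_ext[OF st])
    fix j assume "j \<in> {1..n}"
    then show "s j = t j" using ker[of s j] ker[of t j] st eq by (auto simp: PiE_def)
  qed
qed

text \<open>The coefficient map factors as \<open>?mul\<close>, from coefficients to families of
  summands, followed by summation. Since \<open>?mul\<close> is onto \<open>?N\<close> and the
  composite is bijective, summation is bijective as well.\<close>

lemma (in ring) free_imp_internal_direct_sum:
  assumes y: "y \<in> {1..n} \<rightarrow> carrier R" and free: "free_right_module_on R n y M"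
  shows "internal_direct_sum R n (\<lambda>i. {y i \<otimes> r |r. r \<in> carrier R}) M"
proof -
  let ?N = "\<Pi>\<^sub>E i\<in>{1..n}. {y i \<otimes> r |r. r \<in> carrier R}"
  let ?mul = "\<lambda>s. \<lambda>i\<in>{1..n}. y i \<otimes> s i"
  have comb: "right_comb R n y s = (\<Oplus>i\<in>{1..n}. ?mul s i)" if "s \<in> {1..n} \<rightarrow>\<^sub>E carrier R" for s
    unfolding right_comb_def using that y by (intro finsum_cong') (auto simp: Pi_iff PiE_iff)
  have onto: "?mul ` ({1..n} \<rightarrow>\<^sub>E carrier R) = ?N"
  proof
    show "?N \<subseteq> ?mul ` ({1..n} \<rightarrow>\<^sub>E carrier R)"
    proof
      fix m assume m: "m \<in> ?N"
      then have "\<forall>i\<in>{1..n}. \<exists>r. r \<in> carrier R \<and> m i = y i \<otimes> r" by (auto simp: PiE_iff)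
      then obtain r where r: "\<forall>i\<in>{1..n}. r i \<in> carrier R \<and> m i = y i \<otimes> r i" by metis
      have "m = ?mul (restrict r {1..n})"
        by (rule PiE_ext[OF m]) (use r in \<open>auto simp: PiE_iff\<close>)
      then show "m \<in> ?mul ` ({1..n} \<rightarrow>\<^sub>E carrier R)" using r by (intro image_eqI) auto
    qed
  qed (auto simp: PiE_iff)
  have "bij_betw ((\<lambda>m. \<Oplus>i\<in>{1..n}. m i) \<circ> ?mul) ({1..n} \<rightarrow>\<^sub>E carrier R) M"
    using free unfolding free_right_module_on_def
    by (subst bij_betw_cong[of _ _ "right_comb R n y"]) (simp_all only: o_apply comb)
  then show ?thesis
    unfolding internal_direct_sum_def using onto
    by (metis (no_types, lifting) bij_betw_comp_iff inj_on_imageI2 bij_betw_def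
        inj_on_imp_bij_betw)
qed


section \<open>The Leavitt algebra\<close>

locale leavitt_row =
  fixes K :: "('k, 's) ring_scheme" (structure) and R :: "('k, 'a, 't) module_scheme" (structure)
    and n :: nat and x :: "nat \<Rightarrow> 'a"
  assumes assoc_algebra: "assoc_algebra K R"
    and x_closed: "i \<in> {1..n} \<Longrightarrow> x i \<in> carrier R"
begin

sublocale K: cring K
  using assoc_algebra by (simp add: assoc_algebra_def module_def)

sublocale R: ring R
  using assoc_algebra by (simp add: assoc_algebra_def)

abbreviation L where "L \<equiv> leavitt_algebra K R n x"
abbreviation cls where "cls \<equiv> leavitt_class K R n x"
abbreviation wf where "wf \<equiv> wf_term K R n"
abbreviation leq (infix \<open>\<approx>\<close> 50) where "s \<approx> t \<equiv> leavitt_eq K R n x s t"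

lemma x_funcset: "x \<in> {1..n} \<rightarrow> carrier R"
  using x_closed by blast

lemma wf_foldr_Plus: "(\<And>i. i \<in> set is \<Longrightarrow> wf (f i)) \<Longrightarrow> wf (foldr Plus (map f is) (Base \<zero>\<^bsub>R\<^esub>))"
  by (induction "is") auto

section \<open>Computing with classes of formal expressions\<close>

lemma class_eqI: "s \<approx> t \<Longrightarrow> cls s = cls t"
  unfolding leavitt_class_def by (auto intro: le_sym le_trans)

lemma mem_class: "t \<in> cls s \<longleftrightarrow> s \<approx> t"
  by (simp add: leavitt_class_def)

lemma class_eqD: "cls s = cls t \<Longrightarrow> wf s \<Longrightarrow> t \<approx> s"
  using le_refl mem_class by metis

lemma carrier_L: "carrier L = cls ` {s. wf s}"
  by (simp add: leavitt_algebra_def)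

lemma carrier_LE:
  assumes "a \<in> carrier L"
  obtains s where "wf s" "a = cls s"
  using assms by (auto simp: carrier_L)

lemma class_closed [simp]: "wf s \<Longrightarrow> cls s \<in> carrier L"
  by (simp add: carrier_L)

text \<open>The operations of \<open>leavitt_algebra\<close> are unions over all representatives. If
  the result does not depend on the representative, all members of the union coincide, and
  reflexivity makes the index set nonempty.\<close>

lemma class_lift:
  assumes "wf s" "\<And>s'. s \<approx> s' \<Longrightarrow> F s' = F s"
  shows "(\<Union>s'\<in>cls s. F s') = F s"
proof -
  have "(\<Union>s'\<in>cls s. F s') = (\<Union>s'\<in>cls s. F s)"
    by (intro SUP_cong refl assms(2)) (simp add: mem_class)
  also have "\<dots> = F s"
    using le_refl[OF assms(1)] mem_class by blast
  finally show ?thesis .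
qed

lemma class_lift2:
  assumes "wf s" "wf t" "\<And>s' t'. s \<approx> s' \<Longrightarrow> t \<approx> t' \<Longrightarrow> F s' t' = F s t"
  shows "(\<Union>s'\<in>cls s. \<Union>t'\<in>cls t. F s' t') = F s t"
proof -
  have "(\<Union>s'\<in>cls s. \<Union>t'\<in>cls t. F s' t') = (\<Union>s'\<in>cls s. \<Union>t'\<in>cls t. F s t)"
    by (intro SUP_cong refl assms(3)) (simp_all add: mem_class)
  also have "\<dots> = F s t"
    using le_refl[OF assms(1)] le_refl[OF assms(2)] mem_class by blast
  finally show ?thesis .
qed

lemma class_Plus: "wf s \<Longrightarrow> wf t \<Longrightarrow> cls s \<oplus>\<^bsub>L\<^esub> cls t = cls (Plus s t)"
  by (simp add: leavitt_algebra_def)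
    (rule class_lift2, assumption+, rule class_eqI[OF le_sym[OF le_Plus]])

lemma class_Times: "wf s \<Longrightarrow> wf t \<Longrightarrow> cls s \<otimes>\<^bsub>L\<^esub> cls t = cls (Times s t)"
  by (simp add: leavitt_algebra_def)
    (rule class_lift2, assumption+, rule class_eqI[OF le_sym[OF le_Times]])

lemma class_Scale: "c \<in> carrier K \<Longrightarrow> wf s \<Longrightarrow> c \<odot>\<^bsub>L\<^esub> cls s = cls (Scale c s)"
  unfolding leavitt_algebra_def
  by (simp add: class_lift class_eqI le_Scale le_sym)

lemma L_zero: "\<zero>\<^bsub>L\<^esub> = cls (Base \<zero>\<^bsub>R\<^esub>)" and L_one: "\<one>\<^bsub>L\<^esub> = cls (Base \<one>\<^bsub>R\<^esub>)"
  by (simp_all add: leavitt_algebra_def)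

text \<open>Each ring axiom is a clause of \<open>leavitt_eq\<close>, read on
  representatives.\<close>

lemma ring_L: "ring L"
proof (rule ringI)
  show "abelian_group L"
  proof (rule abelian_groupI)
    fix a assume "a \<in> carrier L"
    then obtain s where s: "wf s" "a = cls s" by (rule carrier_LE)
    then have "cls (Minus s) \<oplus>\<^bsub>L\<^esub> a = \<zero>\<^bsub>L\<^esub>"
      by (simp add: class_Plus L_zero class_eqI le_add_minus)
    then show "\<exists>b\<in>carrier L. b \<oplus>\<^bsub>L\<^esub> a = \<zero>\<^bsub>L\<^esub>" using s by force
  \<comment> \<open>Classes are sets; \<open>equalityI\<close> is deleted so that an equation
    between them is closed by a clause of the congruence instead of being split into two
    inclusions.\<close>
  qed (auto elim!: carrier_LE simp: class_Plus L_zero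
      del: equalityI intro: class_eqI[OF le_add_assoc] class_eqI[OF le_add_comm]
      class_eqI[OF le_add_zero])
  show "monoid L"
    by (rule monoidI)
      (auto elim!: carrier_LE simp: class_Times L_one
        del: equalityI intro: class_eqI[OF le_mult_assoc] class_eqI[OF le_one_left]
        class_eqI[OF le_one_right])
qed (auto elim!: carrier_LE simp: class_Times class_Plus
      del: equalityI intro: class_eqI[OF le_distrib_left] class_eqI[OF le_distrib_right])

sublocale L: ring L
  by (rule ring_L)

section \<open>The canonical map and the inverse column over \<open>L(R)\<close>\<close>

abbreviation \<iota> where "\<iota> \<equiv> leavitt_map K R n x"
abbreviation star where "star \<equiv> leavitt_star K R n x"

lemma \<iota>_hom: "\<iota> \<in> ring_hom R L"
  by (rule ring_hom_memI)
    (auto simp: leavitt_map_def class_Times class_Plus L_one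
      del: equalityI intro: class_eqI[OF le_base_add] class_eqI[OF le_base_mult])

sublocale \<iota>: ring_hom_ring R L \<iota>
  by (rule ring_hom_ringI2) (rule R.ring_axioms ring_L \<iota>_hom)+

lemma star_funcset: "star \<in> {1..n} \<rightarrow> carrier L"
  by (auto simp: leavitt_star_def)

lemma \<iota>_x_funcset: "(\<lambda>i. \<iota> (x i)) \<in> {1..n} \<rightarrow> carrier L"
  using x_closed by auto

lemma star_x:
  assumes "i \<in> {1..n}" "j \<in> {1..n}"
  shows "star i \<otimes>\<^bsub>L\<^esub> \<iota> (x j) = (if i = j then \<one>\<^bsub>L\<^esub> else \<zero>\<^bsub>L\<^esub>)"
proof -
  have "star i \<otimes>\<^bsub>L\<^esub> \<iota> (x j) = cls (Times (Star i) (Base (x j)))"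
    unfolding leavitt_star_def leavitt_map_def using assms x_closed by (intro class_Times) auto
  also have "\<dots> = cls (Base (if i = j then \<one>\<^bsub>R\<^esub> else \<zero>\<^bsub>R\<^esub>))"
    by (intro class_eqI le_star_base assms)
  finally show ?thesis by (simp add: L_zero L_one)
qed

text \<open>The relation \<open>le_sum_star\<close> contains a formal sum over a list. This turns it
  into a sum in \<open>L\<close> over a set, where repeated list entries would be lost.\<close>

lemma class_foldr_Plus:
  "distinct is \<Longrightarrow> (\<And>i. i \<in> set is \<Longrightarrow> wf (f i)) \<Longrightarrow>
    cls (foldr Plus (map f is) (Base \<zero>\<^bsub>R\<^esub>)) = (\<Oplus>\<^bsub>L\<^esub>i\<in>set is. cls (f i))"
proof (induction "is")
  case Nil
  then show ?case by (simp add: L_zero)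
next
  case (Cons i "is")
  then show ?case
    using class_Plus[of "f i" "foldr Plus (map f is) (Base \<zero>\<^bsub>R\<^esub>)"]
    by (simp add: wf_foldr_Plus Pi_iff)
qed

lemma x_star_sum: "(\<Oplus>\<^bsub>L\<^esub>i\<in>{1..n}. \<iota> (x i) \<otimes>\<^bsub>L\<^esub> star i) = \<one>\<^bsub>L\<^esub>"
proof -
  let ?f = "\<lambda>i. Times (Base (x i)) (Star i)"
  have set: "{Suc 0..<Suc n} = {Suc 0..n}" by auto
  have wf: "wf (?f i)" if "i \<in> {1..n}" for i using that x_closed by simp
  have "(\<Oplus>\<^bsub>L\<^esub>i\<in>{1..n}. \<iota> (x i) \<otimes>\<^bsub>L\<^esub> star i) = (\<Oplus>\<^bsub>L\<^esub>i\<in>{1..n}. cls (?f i))"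
    using wf by (intro L.finsum_cong')
      (auto simp: leavitt_map_def leavitt_star_def class_Times)
  also have "\<dots> = cls (foldr Plus (map ?f [1..<Suc n]) (Base \<zero>\<^bsub>R\<^esub>))"
    using wf by (subst class_foldr_Plus) (auto simp del: upt_Suc simp: set)
  also have "\<dots> = \<one>\<^bsub>L\<^esub>"
    unfolding L_one by (intro class_eqI le_sum_star)
  finally show ?thesis .
qed

section \<open>The subring \<open>\<iota>(R)\<close> and its row\<close>

abbreviation S where "S \<equiv> leavitt_image K R n x"

lemma S_eq: "S = L\<lparr>carrier := \<iota> ` carrier R\<rparr>"
  by (simp add: leavitt_image_def)

lemma ring_S: "ring S"
  unfolding S_eq by (rule \<iota>.img_is_ring)

lemma image_subset: "\<iota> ` carrier R \<subseteq> carrier L"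
  by auto

lemma right_comb_S:
  assumes "s \<in> {1..n} \<rightarrow> carrier S"
  shows "right_comb S n (\<lambda>i. \<iota> (x i)) s = right_comb L n (\<lambda>i. \<iota> (x i)) s"
proof -
  have 1: "\<iota> (x i) \<otimes>\<^bsub>L\<^esub> s i \<in> \<iota> ` carrier R" if i: "i \<in> {1..n}" for i
  proof -
    have "s i \<in> \<iota> ` carrier R" using funcset_mem[OF assms i] by (simp add: S_eq)
    then obtain r where "r \<in> carrier R" "s i = \<iota> r" by blast
    then show ?thesis using x_closed[OF i] by (intro image_eqI[of _ _ "x i \<otimes>\<^bsub>R\<^esub> r"]) auto
  qed
  have "finsum S (\<lambda>i. \<iota> (x i) \<otimes>\<^bsub>L\<^esub> s i) {1..n} = finsum L (\<lambda>i. \<iota> (x i) \<otimes>\<^bsub>L\<^esub> s i) {1..n}"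
    unfolding S_eq using 1 ring_L ring_S[unfolded S_eq] image_subset
    by (intro finsum_subring) auto
  then show ?thesis by (simp add: right_comb_def S_eq)
qed

text \<open>Coefficients are recovered by \<open>star j\<close>, which need not lie in
  \<open>S\<close>; the combination is therefore first rewritten as one over
  \<open>L\<close>.\<close>

lemma \<iota>_x_free:
  "free_right_module_on S n (\<lambda>i. \<iota> (x i)) (right_span S n (\<lambda>i. \<iota> (x i)))"
proof (rule ring.free_right_module_onI[OF ring_S, where z = "\<lambda>j a. star j \<otimes>\<^bsub>L\<^esub> a"])
  show "(\<lambda>i. \<iota> (x i)) \<in> {1..n} \<rightarrow> carrier S" using x_closed by (auto simp: S_eq)
  fix s j assume s: "s \<in> {1..n} \<rightarrow> carrier S" and j: "j \<in> {1..n}"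
  then have "s \<in> {1..n} \<rightarrow> carrier L" using image_subset by (auto simp: S_eq)
  then show "star j \<otimes>\<^bsub>L\<^esub> right_comb S n (\<lambda>i. \<iota> (x i)) s = s j"
    unfolding right_comb_S[OF s]
    by (intro L.dual_row_coeff \<iota>_x_funcset star_funcset star_x j)
qed

text \<open>Used twice: for the annihilators in part (1), and to descend from
  \<open>y \<otimes> \<iota> (x i)\<close> to \<open>y\<close> when the kernel of the induced
  homomorphism is computed.\<close>

lemma L_annihilator:
  assumes "a \<in> carrier L" "\<And>i. i \<in> {1..n} \<Longrightarrow> a \<otimes>\<^bsub>L\<^esub> \<iota> (x i) = \<zero>\<^bsub>L\<^esub>"
  shows "a = \<zero>\<^bsub>L\<^esub>"
  using L.dual_row_annihilator[OF _ \<iota>_x_funcset star_funcset x_star_sum] assms by simp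

lemma \<iota>_x_annihilator:
  "trivial_left_annihilator S (right_span S n (\<lambda>i. \<iota> (x i)))"
  unfolding trivial_left_annihilator_def
proof (intro ballI impI)
  fix r assume r: "r \<in> carrier S"
    and 0: "\<forall>a\<in>right_span S n (\<lambda>i. \<iota> (x i)). r \<otimes>\<^bsub>S\<^esub> a = \<zero>\<^bsub>S\<^esub>"
  have "\<iota> (x i) \<in> right_span S n (\<lambda>i. \<iota> (x i))" if "i \<in> {1..n}" for i
    using that x_closed by (intro ring.mem_right_span[OF ring_S]) (auto simp: S_eq)
  then have 1: "r \<otimes>\<^bsub>L\<^esub> \<iota> (x i) = \<zero>\<^bsub>L\<^esub>" if "i \<in> {1..n}" for i
    using 0 that by (simp add: S_eq)
  have "r \<in> carrier L" using r image_subset by (auto simp: S_eq)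
  from this 1 have "r = \<zero>\<^bsub>L\<^esub>" by (rule L_annihilator)
  then show "r = \<zero>\<^bsub>S\<^esub>" by (simp add: S_eq)
qed

section \<open>Transfer between \<open>R\<close> and its image\<close>

lemma \<iota>_right_comb:
  assumes "s \<in> {1..n} \<rightarrow> carrier R"
  shows "\<iota> (right_comb R n x s) = right_comb L n (\<lambda>i. \<iota> (x i)) (\<lambda>i. \<iota> (s i))"
proof -
  have "\<iota> (right_comb R n x s) = (\<Oplus>\<^bsub>L\<^esub>i\<in>{1..n}. \<iota> (x i \<otimes>\<^bsub>R\<^esub> s i))"
    unfolding right_comb_def using assms x_closed
    by (intro ring_hom_finsum[OF R.ring_axioms ring_L \<iota>_hom]) auto
  also have "\<dots> = right_comb L n (\<lambda>i. \<iota> (x i)) (\<lambda>i. \<iota> (s i))"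
    unfolding right_comb_def using assms x_closed
    by (intro L.finsum_cong') (auto simp: Pi_iff)
  finally show ?thesis .
qed

text \<open>In particular \<open>star j\<close> carries the image of the span into
  \<open>\<iota>(R)\<close>. This gives freeness over \<open>R\<close> when \<open>\<iota>\<close>
  is injective, and later places \<open>star j\<close> in \<open>conductor 1\<close>.\<close>

lemma star_\<iota>_right_comb:
  assumes "s \<in> {1..n} \<rightarrow> carrier R" "j \<in> {1..n}"
  shows "star j \<otimes>\<^bsub>L\<^esub> \<iota> (right_comb R n x s) = \<iota> (s j)"
  unfolding \<iota>_right_comb[OF assms(1)] using assms
  by (intro L.dual_row_coeff \<iota>_x_funcset star_funcset star_x) (auto simp: Pi_iff)

text \<open>The coefficient is recovered in \<open>L\<close> and pulled back along
  \<open>\<iota>\<close>, which is possible because \<open>star_\<iota>_right_comb\<close> puts the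
  product into the image.\<close>

lemma inj_imp_free:
  assumes "inj_on \<iota> (carrier R)"
  shows "free_right_module_on R n x (right_span R n x)"
proof (rule R.free_right_module_onI[OF x_funcset,
      where z = "\<lambda>j a. the_inv_into (carrier R) \<iota> (star j \<otimes>\<^bsub>L\<^esub> \<iota> a)"])
  fix s j assume "s \<in> {1..n} \<rightarrow> carrier R" "j \<in> {1..n}"
  then show "the_inv_into (carrier R) \<iota> (star j \<otimes>\<^bsub>L\<^esub> \<iota> (right_comb R n x s)) = s j"
    using assms by (subst star_\<iota>_right_comb) (auto simp: Pi_iff the_inv_into_f_f)
qed

lemma inj_imp_annihilator:
  assumes "inj_on \<iota> (carrier R)"
  shows "trivial_left_annihilator R (right_span R n x)"
  unfolding trivial_left_annihilator_def
proof (intro ballI impI)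
  fix r assume r: "r \<in> carrier R" and 0: "\<forall>a\<in>right_span R n x. r \<otimes>\<^bsub>R\<^esub> a = \<zero>\<^bsub>R\<^esub>"
  have "\<iota> r \<otimes>\<^bsub>L\<^esub> \<iota> (x i) = \<zero>\<^bsub>L\<^esub>" if i: "i \<in> {1..n}" for i
    using 0 R.mem_right_span[OF x_funcset i] r x_closed[OF i] by (metis \<iota>.hom_mult \<iota>.hom_zero)
  then have "\<iota> r = \<iota> \<zero>\<^bsub>R\<^esub>" using r L_annihilator[of "\<iota> r"] by simp
  then show "r = \<zero>\<^bsub>R\<^esub>" using inj_onD[OF assms] r by blast
qed

end

subsection \<open>The universal property\<close>

text \<open>Interpretation of formal expressions in a target algebra, with \<open>h\<close> on
  \<open>R\<close> and \<open>z\<close> on the starred symbols. It descends to classes once the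
  defining relations hold in the target.\<close>

primrec leavitt_eval ::
    "('k, 'b, 'u) module_scheme \<Rightarrow> ('a \<Rightarrow> 'b) \<Rightarrow> (nat \<Rightarrow> 'b) \<Rightarrow> ('k, 'a) leavitt_term \<Rightarrow> 'b"
  where
    "leavitt_eval B h z (Base a) = h a"
  | "leavitt_eval B h z (Star i) = z i"
  | "leavitt_eval B h z (Plus s t) = leavitt_eval B h z s \<oplus>\<^bsub>B\<^esub> leavitt_eval B h z t"
  | "leavitt_eval B h z (Times s t) = leavitt_eval B h z s \<otimes>\<^bsub>B\<^esub> leavitt_eval B h z t"
  | "leavitt_eval B h z (Minus s) = \<ominus>\<^bsub>B\<^esub> leavitt_eval B h z s"
  | "leavitt_eval B h z (Scale c s) = c \<odot>\<^bsub>B\<^esub> leavitt_eval B h z s"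

context leavitt_row
begin

text \<open>The uniqueness half of the universal property: induction on expressions shows that the
  values on the generators force all others.\<close>

lemma induced_hom_eval:
  assumes f: "f \<in> alg_hom K L B" and B: "ring B"
    and h: "\<And>r. r \<in> carrier R \<Longrightarrow> f (\<iota> r) = h r"
    and z: "\<And>i. i \<in> {1..n} \<Longrightarrow> f (star i) = z i"
  shows "wf s \<Longrightarrow> f (cls s) = leavitt_eval B h z s"
proof -
  have "f \<in> ring_hom L B" using f by (simp add: alg_hom_def)
  then interpret f: ring_hom_ring L B f by (intro ring_hom_ringI2 ring_L B)
  show "wf s \<Longrightarrow> f (cls s) = leavitt_eval B h z s"
  proof (induction s)
    case (Base a)
    then show ?case using h[of a] by (simp add: leavitt_map_def)
  next
    case (Star i)
    then show ?case using z[of i] by (simp add: leavitt_star_def)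
  next
    case (Minus s)
    \<comment> \<open>Negation is no field of the record, so the value at \<open>Minus s\<close> is
      recognised as an additive inverse by way of \<open>le_add_minus\<close>.\<close>
    then have "f (cls (Minus s)) \<oplus>\<^bsub>B\<^esub> f (cls s) = f (cls (Minus s) \<oplus>\<^bsub>L\<^esub> cls s)" by simp
    also have "\<dots> = \<zero>\<^bsub>B\<^esub>"
      using Minus by (simp add: class_Plus L_zero[symmetric] class_eqI[OF le_add_minus])
    finally have "f (cls (Minus s)) = \<ominus>\<^bsub>B\<^esub> f (cls s)"
      using f.hom_closed class_closed Minus.prems
      by (intro f.S.minus_equality[symmetric]) auto
    then show ?case using Minus by simp
  next
    case (Scale c s)
    then have "f (c \<odot>\<^bsub>L\<^esub> cls s) = c \<odot>\<^bsub>B\<^esub> f (cls s)"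
      using f class_closed by (auto simp: alg_hom_def)
    then show ?case using Scale by (simp add: class_Scale)
  next
    case (Plus s t)
    then have "f (cls s \<oplus>\<^bsub>L\<^esub> cls t) = f (cls s) \<oplus>\<^bsub>B\<^esub> f (cls t)" by (intro f.hom_add) auto
    then show ?case using Plus by (simp add: class_Plus)
  next
    case (Times s t)
    then have "f (cls s \<otimes>\<^bsub>L\<^esub> cls t) = f (cls s) \<otimes>\<^bsub>B\<^esub> f (cls t)" by (intro f.hom_mult) auto
    then show ?case using Times by (simp add: class_Times)
  qed
qed

lemma eval_foldr_Plus:
  assumes "ring B" "h \<zero>\<^bsub>R\<^esub> = \<zero>\<^bsub>B\<^esub>" "distinct is"
    "\<And>i. i \<in> set is \<Longrightarrow> leavitt_eval B h z (f i) \<in> carrier B"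
  shows "leavitt_eval B h z (foldr Plus (map f is) (Base \<zero>\<^bsub>R\<^esub>)) =
    (\<Oplus>\<^bsub>B\<^esub>i\<in>set is. leavitt_eval B h z (f i))"
proof -
  interpret B: ring B by fact
  show ?thesis using assms(2-4)
    by (induction "is") (auto simp: Pi_iff)
qed

text \<open>Clause by clause, the congruence reflects an algebra axiom of \<open>B\<close>, the
  homomorphism property of \<open>h\<close>, or one of the relations \<open>zx\<close> and
  \<open>xz\<close>. Closure comes first because the axioms of \<open>B\<close> hold only on its
  carrier.\<close>

lemma eval_respects:
  assumes B: "assoc_algebra K B" and h: "h \<in> alg_hom K R B" and z: "z \<in> {1..n} \<rightarrow> carrier B"
    and zx: "\<And>i j. i \<in> {1..n} \<Longrightarrow> j \<in> {1..n} \<Longrightarrow>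
      z i \<otimes>\<^bsub>B\<^esub> h (x j) = (if i = j then \<one>\<^bsub>B\<^esub> else \<zero>\<^bsub>B\<^esub>)"
    and xz: "(\<Oplus>\<^bsub>B\<^esub>i\<in>{1..n}. h (x i) \<otimes>\<^bsub>B\<^esub> z i) = \<one>\<^bsub>B\<^esub>"
  shows "wf s \<Longrightarrow> leavitt_eval B h z s \<in> carrier B"
    and "s \<approx> t \<Longrightarrow> leavitt_eval B h z s = leavitt_eval B h z t"
proof -
  have ringB: "ring B" and modB: "module K B" using B by (simp_all add: assoc_algebra_def)
  interpret B: ring B by (rule ringB)
  have "h \<in> ring_hom R B" using h by (simp add: alg_hom_def)
  then interpret h: ring_hom_ring R B h by (intro ring_hom_ringI2 R.ring_axioms ringB)
  note closed = module.smult_closed[OF modB]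
  have wf_eval: "leavitt_eval B h z s \<in> carrier B" if "wf s" for s
    using that z by (induction s) (auto simp: closed Pi_iff)
  then show "wf s \<Longrightarrow> leavitt_eval B h z s \<in> carrier B" .
  show "leavitt_eval B h z s = leavitt_eval B h z t" if "s \<approx> t"
    using that
  proof (induction rule: leavitt_eq.induct)
    case (le_star_base i j)
    then show ?case using zx[of i j] by simp
  next
    case le_sum_star
    have set: "{Suc 0..<Suc n} = {Suc 0..n}" by auto
    have "leavitt_eval B h z
        (foldr Plus (map (\<lambda>i. Times (Base (x i)) (Star i)) [1..<Suc n]) (Base \<zero>\<^bsub>R\<^esub>))
      = (\<Oplus>\<^bsub>B\<^esub>i\<in>{1..n}. leavitt_eval B h z (Times (Base (x i)) (Star i)))"
      using z x_closed
      by (subst eval_foldr_Plus[OF ringB]) (auto simp: set Pi_iff simp del: upt_Suc)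
    then show ?case using xz by simp
  next
    case (le_add_comm s t)
    then show ?case by (simp add: wf_eval B.a_comm)
  next
    case (le_base_smult c a)
    then show ?case using h by (simp add: alg_hom_def)
  qed (simp_all add: wf_eval closed B.a_assoc B.l_neg B.m_assoc B.l_distr B.r_distr
      module.smult_l_distr[OF modB] module.smult_r_distr[OF modB] module.smult_assoc1[OF modB]
      module.smult_one[OF modB] assoc_algebra.smult_mult_left[OF B]
      assoc_algebra.smult_mult_right[OF B])
qed

theorem leavitt_universal:
  assumes B: "assoc_algebra K B" and h: "h \<in> alg_hom K R B" and z: "z \<in> {1..n} \<rightarrow> carrier B"
    and zx: "\<And>i j. i \<in> {1..n} \<Longrightarrow> j \<in> {1..n} \<Longrightarrow>
      z i \<otimes>\<^bsub>B\<^esub> h (x j) = (if i = j then \<one>\<^bsub>B\<^esub> else \<zero>\<^bsub>B\<^esub>)"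
    and xz: "(\<Oplus>\<^bsub>B\<^esub>i\<in>{1..n}. h (x i) \<otimes>\<^bsub>B\<^esub> z i) = \<one>\<^bsub>B\<^esub>"
  shows "\<exists>!f. f \<in> alg_hom K L B \<and> f \<in> extensional (carrier L) \<and>
    (\<forall>r\<in>carrier R. f (\<iota> r) = h r) \<and> (\<forall>i\<in>{1..n}. f (star i) = z i)"
proof (rule ex_ex1I)
  have ringB: "ring B" using B by (simp add: assoc_algebra_def)
  have closed: "leavitt_eval B h z s \<in> carrier B" if "wf s" for s
    using B h z _ xz that by (rule eval_respects(1)) (rule zx)
  have respects: "leavitt_eval B h z s = leavitt_eval B h z t" if "s \<approx> t" for s t
    using B h z _ xz that by (rule eval_respects(2)) (rule zx)
  \<comment> \<open>Evaluate a chosen well-formed representative; by \<open>respects\<close> the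
    choice is immaterial. The restriction makes \<open>f\<close> extensional.\<close>
  define f where "f = (\<lambda>A\<in>carrier L. leavitt_eval B h z (SOME s. wf s \<and> A = cls s))"
  have f: "f (cls s) = leavitt_eval B h z s" if s: "wf s" for s
  proof -
    define t where "t = (SOME t. wf t \<and> cls s = cls t)"
    have "wf t \<and> cls s = cls t"
      unfolding t_def by (rule someI[of _ s]) (simp add: s)
    then have "leavitt_eval B h z t = leavitt_eval B h z s"
      using class_eqD s by (metis respects)
    moreover have "f (cls s) = leavitt_eval B h z t"
      unfolding f_def t_def by (rule restrict_apply') (rule class_closed[OF s])
    ultimately show ?thesis by simp
  qed
  have "f \<in> ring_hom L B"
    using h by (intro ring_hom_memI)
      (auto elim!: carrier_LE simp: f closed class_Plus class_Times L_one alg_hom_def ring_hom_one)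
  then have "f \<in> alg_hom K L B"
    by (auto simp: alg_hom_def f class_Scale elim!: carrier_LE)
  then show "\<exists>f. f \<in> alg_hom K L B \<and> f \<in> extensional (carrier L) \<and>
    (\<forall>r\<in>carrier R. f (\<iota> r) = h r) \<and> (\<forall>i\<in>{1..n}. f (star i) = z i)"
    by (intro exI[of _ f])
      (use x_closed in \<open>auto simp: f leavitt_map_def leavitt_star_def\<close>, simp add: f_def)
  fix f g
  assume "f \<in> alg_hom K L B \<and> f \<in> extensional (carrier L) \<and>
      (\<forall>r\<in>carrier R. f (\<iota> r) = h r) \<and> (\<forall>i\<in>{1..n}. f (star i) = z i)"
    and "g \<in> alg_hom K L B \<and> g \<in> extensional (carrier L) \<and>
      (\<forall>r\<in>carrier R. g (\<iota> r) = h r) \<and> (\<forall>i\<in>{1..n}. g (star i) = z i)"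
  \<comment> \<open>Both maps are evaluation on every class and undefined outside
    \<open>L\<close>.\<close>
  then show "f = g"
    using induced_hom_eval[of f B h z] induced_hom_eval[of g B h z] ringB
    by (intro extensionalityI[of f "carrier L"]) (auto elim!: carrier_LE)
qed

end


section \<open>The ring of right quotients\<close>

locale ideal_adic =
  fixes K :: "('k, 's) ring_scheme" and R :: "('k, 'a, 't) module_scheme" and I :: "'a set"
  assumes assoc_algebra: "assoc_algebra K R" and ideal: "ideal I R"
begin

sublocale K: cring K
  using assoc_algebra by (simp add: assoc_algebra_def module_def)

sublocale R: ring R
  using assoc_algebra by (simp add: assoc_algebra_def)

sublocale R: module K R
  using assoc_algebra by (simp add: assoc_algebra_def)

section \<open>Powers of the ideal and the maps defined on them\<close>

abbreviation P where "P \<equiv> ideal_pow R I"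

lemma P_0 [simp]: "P 0 = carrier R" and P_Suc: "P (Suc l) = P l \<cdot>\<^bsub>R\<^esub> I"
  by (simp_all add: nat_pow_def ideals_set_def)

declare nat_pow_Suc [simp del] nat_pow_0 [simp del]

lemma ideal_P: "ideal (P l) R"
  by (induction l) (simp_all add: P_Suc R.oneideal R.ideal_prod_is_ideal ideal)

lemma P_carrier: "a \<in> P l \<Longrightarrow> a \<in> carrier R"
  using ideal.Icarr[OF ideal_P] .

lemma P_add: "a \<in> P l \<Longrightarrow> b \<in> P l \<Longrightarrow> a \<oplus>\<^bsub>R\<^esub> b \<in> P l"
  using additive_subgroup.a_closed[OF ideal.axioms(1)[OF ideal_P]] .

lemma P_zero: "\<zero>\<^bsub>R\<^esub> \<in> P l"
  using additive_subgroup.zero_closed[OF ideal.axioms(1)[OF ideal_P]] .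

lemma P_mult_right: "a \<in> P l \<Longrightarrow> r \<in> carrier R \<Longrightarrow> a \<otimes>\<^bsub>R\<^esub> r \<in> P l"
  using ideal.I_r_closed[OF ideal_P] .

lemma P_mult_left: "a \<in> P l \<Longrightarrow> r \<in> carrier R \<Longrightarrow> r \<otimes>\<^bsub>R\<^esub> a \<in> P l"
  using ideal.I_l_closed[OF ideal_P] .

lemma P_plus: "P (l + m) = P l \<cdot>\<^bsub>R\<^esub> P m"
  by (induction m) (simp_all add: P_Suc R.ideal_prod_one R.ideal_prod_assoc ideal_P ideal)

lemma P_antimono: "l \<le> m \<Longrightarrow> P m \<subseteq> P l"
  using R.ideal_prod_inter[OF ideal_P ideal_P, of l "m - l"] P_plus[of l "m - l"] by auto

lemma P_1: "P 1 = I"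
proof
  show "P 1 \<subseteq> I" using R.ideal_prod_inter[OF R.oneideal ideal] by (auto simp: P_Suc)
  show "I \<subseteq> P 1"
  proof
    fix a assume "a \<in> I"
    then show "a \<in> P 1"
      using ideal_prod.prod[of "\<one>\<^bsub>R\<^esub>" "carrier R" a I R] ideal.Icarr[OF ideal] by (simp add: P_Suc)
  qed
qed

lemma right_ideal_P: "right_ideal (P l) R"
  by (simp add: right_ideal_def P_mult_right ideal.axioms(1)[OF ideal_P])

text \<open>Homomorphisms on \<open>P l\<close> without the extensionality demanded by
  \<open>right_module_hom\<close>. Sums, composites and multiplications can then be written as plain
  functions, and one function can be considered on several powers; \<open>quot_class\<close>
  performs the restriction.\<close>

definition partial_hom :: "nat \<Rightarrow> ('a \<Rightarrow> 'a) \<Rightarrow> bool"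
  where "partial_hom l \<phi> \<longleftrightarrow> \<phi> \<in> P l \<rightarrow> carrier R \<and>
    (\<forall>a\<in>P l. \<forall>b\<in>P l. \<phi> (a \<oplus>\<^bsub>R\<^esub> b) = \<phi> a \<oplus>\<^bsub>R\<^esub> \<phi> b) \<and>
    (\<forall>a\<in>P l. \<forall>r\<in>carrier R. \<phi> (a \<otimes>\<^bsub>R\<^esub> r) = \<phi> a \<otimes>\<^bsub>R\<^esub> r)"

lemma right_module_hom_iff:
  "\<phi> \<in> right_module_hom R (P l) \<longleftrightarrow> \<phi> \<in> extensional (P l) \<and> partial_hom l \<phi>"
  by (auto simp: right_module_hom_def partial_hom_def PiE_def)

lemma partial_hom_closed: "partial_hom l \<phi> \<Longrightarrow> a \<in> P l \<Longrightarrow> \<phi> a \<in> carrier R"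
  and partial_hom_add: "partial_hom l \<phi> \<Longrightarrow> a \<in> P l \<Longrightarrow> b \<in> P l \<Longrightarrow> \<phi> (a \<oplus>\<^bsub>R\<^esub> b) = \<phi> a \<oplus>\<^bsub>R\<^esub> \<phi> b"
  and partial_hom_mult: "partial_hom l \<phi> \<Longrightarrow> a \<in> P l \<Longrightarrow> r \<in> carrier R \<Longrightarrow> \<phi> (a \<otimes>\<^bsub>R\<^esub> r) = \<phi> a \<otimes>\<^bsub>R\<^esub> r"
  by (auto simp: partial_hom_def)

lemma partial_hom_cong:
  assumes "\<And>a. a \<in> P l \<Longrightarrow> \<phi> a = \<psi> a"
  shows "partial_hom l \<phi> \<longleftrightarrow> partial_hom l \<psi>"
  using assms by (auto simp: partial_hom_def P_add P_mult_right Pi_iff)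

lemma partial_hom_restrict: "partial_hom l (restrict \<phi> (P l)) \<longleftrightarrow> partial_hom l \<phi>"
  by (rule partial_hom_cong) simp

lemma partial_hom_mono: "partial_hom l \<phi> \<Longrightarrow> l \<le> m \<Longrightarrow> partial_hom m \<phi>"
  using P_antimono[of l m] by (auto simp: partial_hom_def Pi_iff subset_iff)

lemma partial_homs_iff:
  "(l, \<phi>) \<in> partial_homs R I \<longleftrightarrow> \<phi> \<in> extensional (P l) \<and> partial_hom l \<phi>"
  by (simp add: partial_homs_def right_module_hom_iff)

lemma partial_hom_zero:
  assumes "partial_hom l \<phi>"
  shows "\<phi> \<zero>\<^bsub>R\<^esub> = \<zero>\<^bsub>R\<^esub>"
  using partial_hom_mult[OF assms P_zero R.zero_closed] partial_hom_closed[OF assms P_zero] by simp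

lemma partial_hom_finsum:
  assumes "partial_hom l \<phi>" "finite A" "f \<in> A \<rightarrow> P l"
  shows "(\<Oplus>\<^bsub>R\<^esub>i\<in>A. f i) \<in> P l \<and> \<phi> (\<Oplus>\<^bsub>R\<^esub>i\<in>A. f i) = (\<Oplus>\<^bsub>R\<^esub>i\<in>A. \<phi> (f i))"
  using assms(2,3)
proof (induction rule: finite_induct)
  case empty
  show ?case by (simp add: P_zero partial_hom_zero[OF assms(1)])
next
  case (insert a F)
  have "f \<in> F \<rightarrow> carrier R" "f a \<in> carrier R" "f a \<in> P l" using insert P_carrier by blast+
  moreover have "(\<lambda>i. \<phi> (f i)) \<in> F \<rightarrow> carrier R" "\<phi> (f a) \<in> carrier R"
    using insert partial_hom_closed[OF assms(1)] by auto
  ultimately show ?case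
    using insert by (simp add: P_add partial_hom_add[OF assms(1)])
qed

text \<open>The reason why partial homomorphisms compose: \<open>I\<^sup>m\<^sup>+\<^sup>l = I\<^sup>m I\<^sup>l\<close>.\<close>

lemma partial_hom_shift:
  assumes "partial_hom m \<psi>" "m \<le> q" "a \<in> P (q + p)"
  shows "\<psi> a \<in> P p"
proof -
  have Pq: "P q \<subseteq> P m" using assms(2) by (rule P_antimono)
  have sub: "P q \<cdot>\<^bsub>R\<^esub> P p \<subseteq> P m"
    using R.ideal_prod_inter[OF ideal_P ideal_P] Pq by blast
  have "a \<in> P q \<cdot>\<^bsub>R\<^esub> P p" using assms(3) by (simp add: P_plus)
  then show ?thesis
  proof (induction rule: ideal_prod.induct)
    case (prod b c)
    then have "\<psi> (b \<otimes>\<^bsub>R\<^esub> c) = \<psi> b \<otimes>\<^bsub>R\<^esub> c"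
      using Pq P_carrier by (intro partial_hom_mult[OF assms(1)]) auto
    then show ?case
      using prod Pq partial_hom_closed[OF assms(1)] by (auto intro: P_mult_left)
  next
    case (sum b c)
    then show ?case
      using partial_hom_add[OF assms(1), of b c] sub[THEN subsetD] P_add by simp
  qed
qed

section \<open>Classes in the direct limit\<close>

abbreviation Q where "Q \<equiv> quotient_algebra R I"
abbreviation qc where "qc \<equiv> quot_class R I"

lemma mem_quot_class:
  assumes "partial_hom l \<phi>"
  shows "(m, \<psi>) \<in> qc l \<phi> \<longleftrightarrow> (m, \<psi>) \<in> partial_homs R I \<and>
    (\<exists>p. l \<le> p \<and> m \<le> p \<and> (\<forall>a\<in>P p. \<phi> a = \<psi> a))"
proof -
  have "(\<forall>a\<in>P p. restrict \<phi> (P l) a = \<psi> a) \<longleftrightarrow> (\<forall>a\<in>P p. \<phi> a = \<psi> a)" if "l \<le> p" for p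
    using P_antimono[OF that] by (intro ball_cong) auto
  moreover have "(l, restrict \<phi> (P l)) \<in> partial_homs R I"
    using assms by (simp add: partial_homs_iff partial_hom_restrict)
  ultimately show ?thesis
    unfolding quot_class_def quot_rel_def by (simp cong: conj_cong)
qed

lemma quot_classE:
  assumes "(m, \<psi>) \<in> qc l \<phi>" "partial_hom l \<phi>"
  obtains p where "partial_hom m \<psi>" "l \<le> p" "m \<le> p" "\<And>a. a \<in> P p \<Longrightarrow> \<psi> a = \<phi> a"
  using assms by (auto simp: mem_quot_class partial_homs_iff)

lemma quot_class_self: "partial_hom l \<phi> \<Longrightarrow> (l, restrict \<phi> (P l)) \<in> qc l \<phi>"
  by (subst mem_quot_class) (auto simp: partial_homs_iff partial_hom_restrict)

lemma quot_class_eqI: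
  assumes \<phi>: "partial_hom l \<phi>" and \<psi>: "partial_hom m \<psi>"
    and p: "l \<le> p" "m \<le> p" "\<And>a. a \<in> P p \<Longrightarrow> \<phi> a = \<psi> a"
  shows "qc l \<phi> = qc m \<psi>"
proof -
  \<comment> \<open>Both inclusions are instances of this statement. Agreement on \<open>P p\<close>
    and agreement on \<open>P q\<close> combine on the smaller power
    \<open>P (max p q)\<close>.\<close>
  have *: "(k, \<chi>) \<in> qc m \<psi>" if h: "partial_hom l \<phi>" "partial_hom m \<psi>" "l \<le> p" "m \<le> p"
    "\<And>a. a \<in> P p \<Longrightarrow> \<phi> a = \<psi> a" "(k, \<chi>) \<in> qc l \<phi>" for l m \<phi> \<psi> k \<chi>
  proof -
    obtain q where q: "l \<le> q" "k \<le> q" "\<forall>a\<in>P q. \<phi> a = \<chi> a"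
      and k: "(k, \<chi>) \<in> partial_homs R I" using h(6) mem_quot_class[OF h(1)] by blast
    have "\<forall>a\<in>P (max p q). \<psi> a = \<chi> a"
      using q(3) h(5) P_antimono[of p "max p q"] P_antimono[of q "max p q"] by fastforce
    then show ?thesis
      using q k h(1-4) by (subst mem_quot_class) (auto intro!: exI[of _ "max p q"])
  qed
  show ?thesis
    using *[OF \<phi> \<psi> p] *[OF \<psi> \<phi> p(2,1) p(3)[symmetric]] by auto
qed

lemma quot_class_eqD:
  assumes "qc l \<phi> = qc m \<psi>" "partial_hom l \<phi>" "partial_hom m \<psi>"
  obtains p where "l \<le> p" "m \<le> p" "\<And>a. a \<in> P p \<Longrightarrow> \<phi> a = \<psi> a"
proof -
  have "(l, restrict \<phi> (P l)) \<in> qc m \<psi>" using quot_class_self[OF assms(2)] assms(1) by simp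
  then obtain p where p: "m \<le> p" "l \<le> p" "\<And>a. a \<in> P p \<Longrightarrow> restrict \<phi> (P l) a = \<psi> a"
    using assms(3) by (rule quot_classE) blast
  have "\<phi> a = \<psi> a" if "a \<in> P p" for a
    using p(3)[OF that] that P_antimono[OF p(2)] by auto
  then show ?thesis using that p by blast
qed

lemma quot_class_mono: "partial_hom l \<phi> \<Longrightarrow> l \<le> m \<Longrightarrow> qc l \<phi> = qc m \<phi>"
  by (rule quot_class_eqI[of _ _ _ _ m]) (auto intro: partial_hom_mono)

lemma carrier_Q: "carrier Q = {qc l \<phi> |l \<phi>. partial_hom l \<phi>}"
proof -
  have "carrier Q = (\<lambda>(l, \<phi>). quot_rel R I `` {(l, \<phi>)}) ` partial_homs R I"
    unfolding quotient_algebra_def quotient_def by auto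
  also have "\<dots> = {qc l \<phi> |l \<phi>. partial_hom l \<phi>}"
  proof (intro equalityI subsetI)
    fix A assume "A \<in> {qc l \<phi> |l \<phi>. partial_hom l \<phi>}"
    then obtain l \<phi> where A: "A = qc l \<phi>" "partial_hom l \<phi>" by blast
    then show "A \<in> (\<lambda>(l, \<phi>). quot_rel R I `` {(l, \<phi>)}) ` partial_homs R I"
      by (intro image_eqI[of _ _ "(l, restrict \<phi> (P l))"])
        (simp_all add: quot_class_def partial_homs_iff partial_hom_restrict)
  next
    fix A assume "A \<in> (\<lambda>(l, \<phi>). quot_rel R I `` {(l, \<phi>)}) ` partial_homs R I"
    then obtain l \<phi> where A: "A = quot_rel R I `` {(l, \<phi>)}" "(l, \<phi>) \<in> partial_homs R I" by auto
    then have "A = qc l \<phi>" "partial_hom l \<phi>"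
      by (simp_all add: quot_class_def partial_homs_iff extensional_restrict)
    then show "A \<in> {qc l \<phi> |l \<phi>. partial_hom l \<phi>}" by blast
  qed
  finally show ?thesis .
qed

lemma quot_class_closed [simp]: "partial_hom l \<phi> \<Longrightarrow> qc l \<phi> \<in> carrier Q"
  by (auto simp: carrier_Q)

lemma carrier_QE:
  assumes "A \<in> carrier Q"
  obtains l \<phi> where "partial_hom l \<phi>" "A = qc l \<phi>"
  using assms by (auto simp: carrier_Q)

text \<open>Restriction yields representatives at all sufficiently large levels, so finitely many
  elements of \<open>Q\<close> can be represented at one common level.\<close>

lemma carrier_Q_ge:
  assumes "A \<in> carrier Q"
  obtains l where "\<And>m. l \<le> m \<Longrightarrow> \<exists>\<phi>. partial_hom m \<phi> \<and> A = qc m \<phi>"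
proof -
  obtain l \<phi> where "partial_hom l \<phi>" "A = qc l \<phi>" using assms by (rule carrier_QE)
  then show ?thesis using that[of l] partial_hom_mono quot_class_mono by blast
qed

lemma carrier_Q3:
  assumes "A \<in> carrier Q" "B \<in> carrier Q" "C \<in> carrier Q"
  obtains l \<phi> \<psi> \<chi> where "partial_hom l \<phi>" "A = qc l \<phi>" "partial_hom l \<psi>" "B = qc l \<psi>"
    "partial_hom l \<chi>" "C = qc l \<chi>"
proof -
  obtain l1 where 1: "\<And>m. l1 \<le> m \<Longrightarrow> \<exists>\<phi>. partial_hom m \<phi> \<and> A = qc m \<phi>"
    using carrier_Q_ge[OF assms(1)] by blast
  obtain l2 where 2: "\<And>m. l2 \<le> m \<Longrightarrow> \<exists>\<phi>. partial_hom m \<phi> \<and> B = qc m \<phi>"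
    using carrier_Q_ge[OF assms(2)] by blast
  obtain l3 where 3: "\<And>m. l3 \<le> m \<Longrightarrow> \<exists>\<phi>. partial_hom m \<phi> \<and> C = qc m \<phi>"
    using carrier_Q_ge[OF assms(3)] by blast
  show ?thesis using 1[of "l1 + l2 + l3"] 2[of "l1 + l2 + l3"] 3[of "l1 + l2 + l3"] that by auto
qed

lemma carrier_Q2:
  assumes "A \<in> carrier Q" "B \<in> carrier Q"
  obtains l \<phi> \<psi> where "partial_hom l \<phi>" "A = qc l \<phi>" "partial_hom l \<psi>" "B = qc l \<psi>"
  by (rule carrier_Q3[OF assms assms(2)]) (rule that)

section \<open>Operations on representatives and their well-definedness\<close>

lemma partial_hom_plus:
  assumes "partial_hom l \<phi>" "partial_hom l \<psi>"
  shows "partial_hom l (\<lambda>a. \<phi> a \<oplus>\<^bsub>R\<^esub> \<psi> a)"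
  using assms partial_hom_closed[OF assms(1)] partial_hom_closed[OF assms(2)]
  by (auto simp: partial_hom_def R.add.m_ac R.l_distr)

lemma partial_hom_uminus:
  assumes "partial_hom l \<phi>"
  shows "partial_hom l (\<lambda>a. \<ominus>\<^bsub>R\<^esub> \<phi> a)"
  using assms partial_hom_closed[OF assms(1)]
  by (auto simp: partial_hom_def R.minus_add R.l_minus)

lemma partial_hom_scale:
  assumes "c \<in> carrier K" "partial_hom l \<phi>"
  shows "partial_hom l (\<lambda>a. c \<odot>\<^bsub>R\<^esub> \<phi> a)"
  using assms partial_hom_closed[OF assms(2)]
  by (auto simp: partial_hom_def R.smult_r_distr assoc_algebra.smult_mult_left[OF assoc_algebra])

lemma partial_hom_comp:
  assumes "partial_hom l \<phi>" "partial_hom m \<psi>"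
  shows "partial_hom (l + m) (\<lambda>a. \<phi> (\<psi> a))"
proof -
  have m: "a \<in> P m" if "a \<in> P (l + m)" for a
    using that P_antimono[of m "l + m"] by auto
  have l: "\<psi> a \<in> P l" if "a \<in> P (l + m)" for a
    using that by (intro partial_hom_shift[OF assms(2) order.refl]) (simp add: add.commute)
  show ?thesis
    unfolding partial_hom_def[of "l + m"]
    using m l partial_hom_closed[OF assms(1)]
    by (auto simp: partial_hom_add[OF assms(1)] partial_hom_add[OF assms(2)]
        partial_hom_mult[OF assms(1)] partial_hom_mult[OF assms(2)])
qed

lemma partial_hom_left_mult: "r \<in> carrier R \<Longrightarrow> partial_hom l (\<lambda>a. r \<otimes>\<^bsub>R\<^esub> a)"
  by (auto simp: partial_hom_def P_carrier R.r_distr R.m_assoc)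

lemma partial_hom_ident: "partial_hom l (\<lambda>a. a)"
  by (auto simp: partial_hom_def P_carrier)

lemma partial_hom_const_zero: "partial_hom l (\<lambda>a. \<zero>\<^bsub>R\<^esub>)"
  by (auto simp: partial_hom_def)

lemma UN_const:
  assumes "A \<noteq> {}" "\<And>a. a \<in> A \<Longrightarrow> F a = c"
  shows "(\<Union>a\<in>A. F a) = c"
  using assms by auto

text \<open>Other representatives agree with \<open>\<phi>\<close> and \<open>\<psi>\<close> on
  powers \<open>P p\<close> and \<open>P q\<close>, so their sum agrees with the given one on
  \<open>P (max p q)\<close>.\<close>

lemma quot_class_add:
  assumes \<phi>: "partial_hom l \<phi>" and \<psi>: "partial_hom l \<psi>"
  shows "qc l \<phi> \<oplus>\<^bsub>Q\<^esub> qc l \<psi> = qc l (\<lambda>a. \<phi> a \<oplus>\<^bsub>R\<^esub> \<psi> a)"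
proof -
  have "qc (max l' m') (\<lambda>a. \<phi>' a \<oplus>\<^bsub>R\<^esub> \<psi>' a) = qc l (\<lambda>a. \<phi> a \<oplus>\<^bsub>R\<^esub> \<psi> a)"
    if rep: "(l', \<phi>') \<in> qc l \<phi>" "(m', \<psi>') \<in> qc l \<psi>" for l' \<phi>' m' \<psi>'
  proof -
    obtain p where p: "partial_hom l' \<phi>'" "l \<le> p" "l' \<le> p" "\<And>a. a \<in> P p \<Longrightarrow> \<phi>' a = \<phi> a"
      using quot_classE[OF rep(1) \<phi>] by blast
    obtain q where q: "partial_hom m' \<psi>'" "l \<le> q" "m' \<le> q" "\<And>a. a \<in> P q \<Longrightarrow> \<psi>' a = \<psi> a"
      using quot_classE[OF rep(2) \<psi>] by blast
    show ?thesis
    proof (rule quot_class_eqI[where p = "max p q"])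
      show "partial_hom (max l' m') (\<lambda>a. \<phi>' a \<oplus>\<^bsub>R\<^esub> \<psi>' a)"
        using p(1) q(1) by (intro partial_hom_plus) (auto intro: partial_hom_mono)
      show "\<phi>' a \<oplus>\<^bsub>R\<^esub> \<psi>' a = \<phi> a \<oplus>\<^bsub>R\<^esub> \<psi> a" if "a \<in> P (max p q)" for a
        using that p(4) q(4) P_antimono[of p "max p q"] P_antimono[of q "max p q"]
        by (simp add: subset_iff)
    qed (use p q partial_hom_plus[OF \<phi> \<psi>] in auto)
  qed
  then show ?thesis
    using quot_class_self[OF \<phi>] quot_class_self[OF \<psi>]
    by (auto simp: quotient_algebra_def intro!: UN_const)
qed

lemma quot_class_mult:
  assumes \<phi>: "partial_hom l \<phi>" and \<psi>: "partial_hom m \<psi>"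
  shows "qc l \<phi> \<otimes>\<^bsub>Q\<^esub> qc m \<psi> = qc (l + m) (\<lambda>a. \<phi> (\<psi> a))"
proof -
  have "qc (l' + m') (\<lambda>a. \<phi>' (\<psi>' a)) = qc (l + m) (\<lambda>a. \<phi> (\<psi> a))"
    if rep: "(l', \<phi>') \<in> qc l \<phi>" "(m', \<psi>') \<in> qc m \<psi>" for l' \<phi>' m' \<psi>'
  proof -
    obtain p where p: "partial_hom l' \<phi>'" "l \<le> p" "l' \<le> p" "\<And>a. a \<in> P p \<Longrightarrow> \<phi>' a = \<phi> a"
      using quot_classE[OF rep(1) \<phi>] by blast
    obtain q where q: "partial_hom m' \<psi>'" "m \<le> q" "m' \<le> q" "\<And>a. a \<in> P q \<Longrightarrow> \<psi>' a = \<psi> a"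
      using quot_classE[OF rep(2) \<psi>] by blast
    \<comment> \<open>On \<open>P (q + p)\<close> the inner maps agree, since it lies in
      \<open>P q\<close>; moreover \<open>\<psi>\<close> sends it into \<open>P p\<close>, where the
      outer maps agree.\<close>
    show ?thesis
    proof (rule quot_class_eqI[where p = "q + p"])
      show "\<phi>' (\<psi>' a) = \<phi> (\<psi> a)" if a: "a \<in> P (q + p)" for a
      proof -
        have "\<psi>' a = \<psi> a" using a q(4) P_antimono[of q "q + p"] by auto
        moreover have "\<psi> a \<in> P p" using partial_hom_shift[OF \<psi> q(2) a] .
        ultimately show ?thesis using p(4) by simp
      qed
    qed (use p q partial_hom_comp[OF \<phi> \<psi>] partial_hom_comp[OF p(1) q(1)] in auto)
  qed
  then show ?thesis
    using quot_class_self[OF \<phi>] quot_class_self[OF \<psi>]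
    by (auto simp: quotient_algebra_def intro!: UN_const)
qed

lemma quot_class_scale:
  assumes c: "c \<in> carrier K" and \<phi>: "partial_hom l \<phi>"
  shows "c \<odot>\<^bsub>Q\<^esub> qc l \<phi> = qc l (\<lambda>a. c \<odot>\<^bsub>R\<^esub> \<phi> a)"
proof -
  have "qc l' (\<lambda>a. c \<odot>\<^bsub>R\<^esub> \<phi>' a) = qc l (\<lambda>a. c \<odot>\<^bsub>R\<^esub> \<phi> a)"
    if rep: "(l', \<phi>') \<in> qc l \<phi>" for l' \<phi>'
  proof -
    obtain p where p: "partial_hom l' \<phi>'" "l \<le> p" "l' \<le> p" "\<And>a. a \<in> P p \<Longrightarrow> \<phi>' a = \<phi> a"
      using quot_classE[OF rep \<phi>] by blast
    then show ?thesis
      by (intro quot_class_eqI[where p = p] partial_hom_scale c \<phi>) auto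
  qed
  then show ?thesis
    using quot_class_self[OF \<phi>] by (auto simp: quotient_algebra_def intro!: UN_const)
qed

text \<open>The level is left free because \<open>quot_class_add\<close> expects both summands at
  the same one.\<close>

lemma Q_zero: "\<zero>\<^bsub>Q\<^esub> = qc l (\<lambda>a. \<zero>\<^bsub>R\<^esub>)"
proof -
  have "\<zero>\<^bsub>Q\<^esub> = qc 0 (\<lambda>a. \<zero>\<^bsub>R\<^esub>)" by (simp add: quotient_algebra_def)
  then show ?thesis using quot_class_mono[OF partial_hom_const_zero, of 0 l] by simp
qed

lemma Q_one: "\<one>\<^bsub>Q\<^esub> = qc l (\<lambda>a. a)"
proof -
  have "\<one>\<^bsub>Q\<^esub> = qc 0 (\<lambda>a. a)" by (simp add: quotient_algebra_def)
  then show ?thesis using quot_class_mono[OF partial_hom_ident, of 0 l] by simp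
qed

lemma quot_class_cong:
  assumes "partial_hom l \<phi>" "\<And>a. a \<in> P l \<Longrightarrow> \<phi> a = \<psi> a"
  shows "qc l \<phi> = qc l \<psi>"
  using assms partial_hom_cong[of l \<phi> \<psi>] by (intro quot_class_eqI[where p = l]) auto

section \<open>The algebra axioms for \<open>Q(R)\<close>\<close>

lemma abelian_group_Q: "abelian_group Q"
proof (rule abelian_groupI)
  fix A B C assume "A \<in> carrier Q" "B \<in> carrier Q" "C \<in> carrier Q"
  then obtain l \<phi> \<psi> \<chi> where h: "partial_hom l \<phi>" "A = qc l \<phi>" "partial_hom l \<psi>" "B = qc l \<psi>"
    "partial_hom l \<chi>" "C = qc l \<chi>" by (rule carrier_Q3)
  then show "A \<oplus>\<^bsub>Q\<^esub> B \<oplus>\<^bsub>Q\<^esub> C = A \<oplus>\<^bsub>Q\<^esub> (B \<oplus>\<^bsub>Q\<^esub> C)"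
    by (auto simp: quot_class_add partial_hom_plus partial_hom_closed R.a_assoc
        intro!: quot_class_cong)
next
  fix A B assume "A \<in> carrier Q" "B \<in> carrier Q"
  then obtain l \<phi> \<psi> where h: "partial_hom l \<phi>" "A = qc l \<phi>" "partial_hom l \<psi>" "B = qc l \<psi>"
    by (rule carrier_Q2)
  then show "A \<oplus>\<^bsub>Q\<^esub> B \<in> carrier Q" by (simp add: quot_class_add partial_hom_plus)
  show "A \<oplus>\<^bsub>Q\<^esub> B = B \<oplus>\<^bsub>Q\<^esub> A"
    using h by (auto simp: quot_class_add partial_hom_plus partial_hom_closed R.a_comm
        intro!: quot_class_cong)
next
  fix A assume "A \<in> carrier Q"
  then obtain l \<phi> where h: "partial_hom l \<phi>" "A = qc l \<phi>" by (rule carrier_QE)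
  then show "\<zero>\<^bsub>Q\<^esub> \<oplus>\<^bsub>Q\<^esub> A = A"
    by (auto simp: Q_zero[of l] quot_class_add partial_hom_const_zero partial_hom_plus
        partial_hom_closed intro!: quot_class_cong)
  have "qc l (\<lambda>a. \<ominus>\<^bsub>R\<^esub> \<phi> a) \<oplus>\<^bsub>Q\<^esub> A = \<zero>\<^bsub>Q\<^esub>"
    using h by (auto simp: Q_zero[of l] quot_class_add partial_hom_uminus partial_hom_plus
        partial_hom_closed R.l_neg intro!: quot_class_cong)
  then show "\<exists>B\<in>carrier Q. B \<oplus>\<^bsub>Q\<^esub> A = \<zero>\<^bsub>Q\<^esub>"
    using h partial_hom_uminus by (intro bexI[of _ "qc l (\<lambda>a. \<ominus>\<^bsub>R\<^esub> \<phi> a)"]) auto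
qed (simp add: Q_zero[of 0] partial_hom_const_zero)

lemma monoid_Q: "monoid Q"
proof (rule monoidI)
  fix A B C assume "A \<in> carrier Q" "B \<in> carrier Q" "C \<in> carrier Q"
  then show "A \<otimes>\<^bsub>Q\<^esub> B \<otimes>\<^bsub>Q\<^esub> C = A \<otimes>\<^bsub>Q\<^esub> (B \<otimes>\<^bsub>Q\<^esub> C)"
    by (elim carrier_QE) (simp add: quot_class_mult partial_hom_comp add.assoc)
next
  fix A B assume "A \<in> carrier Q" "B \<in> carrier Q"
  then show "A \<otimes>\<^bsub>Q\<^esub> B \<in> carrier Q"
    by (elim carrier_QE) (simp add: quot_class_mult partial_hom_comp)
next
  fix A assume "A \<in> carrier Q"
  then show "\<one>\<^bsub>Q\<^esub> \<otimes>\<^bsub>Q\<^esub> A = A" "A \<otimes>\<^bsub>Q\<^esub> \<one>\<^bsub>Q\<^esub> = A"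
    by (elim carrier_QE; simp add: quot_class_mult partial_hom_ident Q_one[of 0])+
qed (simp add: Q_one[of 0] partial_hom_ident)

lemma ring_Q: "ring Q"
proof (rule ringI)
  fix A B C assume AB: "A \<in> carrier Q" "B \<in> carrier Q" and C: "C \<in> carrier Q"
  obtain l \<phi> \<psi> where h: "partial_hom l \<phi>" "A = qc l \<phi>" "partial_hom l \<psi>" "B = qc l \<psi>"
    using AB by (rule carrier_Q2)
  obtain m \<chi> where C: "partial_hom m \<chi>" "C = qc m \<chi>" using C by (rule carrier_QE)
  show "(A \<oplus>\<^bsub>Q\<^esub> B) \<otimes>\<^bsub>Q\<^esub> C = A \<otimes>\<^bsub>Q\<^esub> C \<oplus>\<^bsub>Q\<^esub> B \<otimes>\<^bsub>Q\<^esub> C"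
    using h C by (simp add: quot_class_add quot_class_mult partial_hom_plus partial_hom_comp)
  \<comment> \<open>The law above is immediate from pointwise addition. In the other one
    \<open>\<chi>\<close> must be additive on values of \<open>\<phi>\<close> and
    \<open>\<psi>\<close>, which therefore have to lie in its domain.\<close>
  have [simp]: "\<phi> a \<in> P m" "\<psi> a \<in> P m" if "a \<in> P (m + l)" for a
    using that h partial_hom_shift[OF _ order.refl] by (auto simp: add.commute)
  show "C \<otimes>\<^bsub>Q\<^esub> (A \<oplus>\<^bsub>Q\<^esub> B) = C \<otimes>\<^bsub>Q\<^esub> A \<oplus>\<^bsub>Q\<^esub> C \<otimes>\<^bsub>Q\<^esub> B"
    using h C partial_hom_comp[OF C(1) partial_hom_plus[OF h(1,3)]]
    by (auto simp: quot_class_add quot_class_mult partial_hom_plus partial_hom_comp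
        partial_hom_add intro!: quot_class_cong)
qed (rule abelian_group_Q monoid_Q)+

lemma module_Q: "module K Q"
proof (rule moduleI)
  fix c d A assume cd: "c \<in> carrier K" "d \<in> carrier K" and "A \<in> carrier Q"
  then obtain l \<phi> where h: "partial_hom l \<phi>" "A = qc l \<phi>" by (elim carrier_QE)
  show "(c \<oplus>\<^bsub>K\<^esub> d) \<odot>\<^bsub>Q\<^esub> A = c \<odot>\<^bsub>Q\<^esub> A \<oplus>\<^bsub>Q\<^esub> d \<odot>\<^bsub>Q\<^esub> A"
    using h cd by (auto simp: quot_class_scale quot_class_add partial_hom_scale partial_hom_closed
        R.smult_l_distr intro!: quot_class_cong)
  show "(c \<otimes>\<^bsub>K\<^esub> d) \<odot>\<^bsub>Q\<^esub> A = c \<odot>\<^bsub>Q\<^esub> (d \<odot>\<^bsub>Q\<^esub> A)"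
    using h cd by (auto simp: quot_class_scale partial_hom_scale partial_hom_closed
        R.smult_assoc1 intro!: quot_class_cong)
next
  fix c A B assume c: "c \<in> carrier K" and AB: "A \<in> carrier Q" "B \<in> carrier Q"
  obtain l \<phi> \<psi> where h: "partial_hom l \<phi>" "A = qc l \<phi>" "partial_hom l \<psi>" "B = qc l \<psi>"
    using AB by (rule carrier_Q2)
  show "c \<odot>\<^bsub>Q\<^esub> A \<in> carrier Q" using h c by (simp add: quot_class_scale partial_hom_scale)
  show "c \<odot>\<^bsub>Q\<^esub> (A \<oplus>\<^bsub>Q\<^esub> B) = c \<odot>\<^bsub>Q\<^esub> A \<oplus>\<^bsub>Q\<^esub> c \<odot>\<^bsub>Q\<^esub> B"
    using h c by (auto simp: quot_class_scale quot_class_add partial_hom_scale partial_hom_plus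
        partial_hom_closed R.smult_r_distr intro!: quot_class_cong)
next
  fix A assume "A \<in> carrier Q"
  then show "\<one>\<^bsub>K\<^esub> \<odot>\<^bsub>Q\<^esub> A = A"
    by (elim carrier_QE) (auto simp: quot_class_scale partial_hom_scale partial_hom_closed
        intro!: quot_class_cong)
qed (rule K.is_cring abelian_group_Q)+

text \<open>A scalar acts as right multiplication by \<open>c \<odot> \<one>\<close>, so linearity
  over \<open>K\<close> follows from linearity over \<open>R\<close>.\<close>

lemma partial_hom_smult:
  assumes c: "c \<in> carrier K" and \<phi>: "partial_hom l \<phi>" and a: "a \<in> P l"
  shows "\<phi> (c \<odot>\<^bsub>R\<^esub> a) = c \<odot>\<^bsub>R\<^esub> \<phi> a"
proof -
  note smult_mult_right = assoc_algebra.smult_mult_right[OF assoc_algebra]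
  have "\<phi> (c \<odot>\<^bsub>R\<^esub> a) = \<phi> (a \<otimes>\<^bsub>R\<^esub> (c \<odot>\<^bsub>R\<^esub> \<one>\<^bsub>R\<^esub>))"
    using c a P_carrier by (simp add: smult_mult_right)
  also have "\<dots> = \<phi> a \<otimes>\<^bsub>R\<^esub> (c \<odot>\<^bsub>R\<^esub> \<one>\<^bsub>R\<^esub>)"
    using c a by (intro partial_hom_mult[OF \<phi>]) auto
  also have "\<dots> = c \<odot>\<^bsub>R\<^esub> \<phi> a"
    using c a partial_hom_closed[OF \<phi>] by (simp add: smult_mult_right)
  finally show ?thesis .
qed

lemma assoc_algebra_Q: "assoc_algebra K Q"
proof (intro assoc_algebra.intro assoc_algebra_axioms.intro module_Q ring_Q)
  fix c A B assume c: "c \<in> carrier K" and "A \<in> carrier Q" "B \<in> carrier Q"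
  then obtain l \<phi> m \<psi> where h: "partial_hom l \<phi>" "A = qc l \<phi>" "partial_hom m \<psi>" "B = qc m \<psi>"
    by (elim carrier_QE)
  show "(c \<odot>\<^bsub>Q\<^esub> A) \<otimes>\<^bsub>Q\<^esub> B = c \<odot>\<^bsub>Q\<^esub> (A \<otimes>\<^bsub>Q\<^esub> B)"
    using h c by (simp add: quot_class_scale quot_class_mult partial_hom_scale partial_hom_comp)
  have [simp]: "\<psi> a \<in> P l" if "a \<in> P (l + m)" for a
    using that h partial_hom_shift[OF _ order.refl] by (auto simp: add.commute)
  show "A \<otimes>\<^bsub>Q\<^esub> (c \<odot>\<^bsub>Q\<^esub> B) = c \<odot>\<^bsub>Q\<^esub> (A \<otimes>\<^bsub>Q\<^esub> B)"
    using h c partial_hom_comp[OF h(1) partial_hom_scale[OF c h(3)]]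
    by (auto simp: quot_class_scale quot_class_mult partial_hom_scale partial_hom_comp
        partial_hom_smult intro!: quot_class_cong)
qed

section \<open>The canonical map into \<open>Q(R)\<close> and finite sums of classes\<close>

lemma quotient_map_eq: "r \<in> carrier R \<Longrightarrow> quotient_map R I r = qc l (\<lambda>a. r \<otimes>\<^bsub>R\<^esub> a)"
  unfolding quotient_map_def using quot_class_mono[OF partial_hom_left_mult, of r 0 l] by simp

lemma quotient_map_hom: "quotient_map R I \<in> alg_hom K R Q"
proof -
  have "quotient_map R I \<in> ring_hom R Q"
    by (rule ring_hom_memI)
      (auto simp: quotient_map_eq[of _ 0] quot_class_mult quot_class_add partial_hom_left_mult
        partial_hom_comp partial_hom_plus Q_one[of 0] R.m_assoc R.l_distr
        simp del: P_0 intro!: quot_class_cong dest: P_carrier)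
  then show ?thesis
    by (auto simp: alg_hom_def quotient_map_eq[of _ 0] quot_class_scale partial_hom_left_mult
        partial_hom_scale assoc_algebra.smult_mult_left[OF assoc_algebra]
        simp del: P_0 intro!: quot_class_cong dest: P_carrier)
qed

end

context ideal_adic
begin

text \<open>The two claims are proved together: adding one more class requires the previous sum to
  be a partial homomorphism.\<close>

lemma quot_class_finsum:
  assumes "finite A" "\<And>i. i \<in> A \<Longrightarrow> partial_hom l (f i)"
  shows "partial_hom l (\<lambda>a. \<Oplus>\<^bsub>R\<^esub>i\<in>A. f i a) \<and>
    (\<Oplus>\<^bsub>Q\<^esub>i\<in>A. qc l (f i)) = qc l (\<lambda>a. \<Oplus>\<^bsub>R\<^esub>i\<in>A. f i a)"
  using assms
proof (induction rule: finite_induct)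
  case empty
  interpret Q: ring Q by (rule ring_Q)
  show ?case by (simp add: partial_hom_const_zero Q_zero[of l])
next
  case (insert i F)
  interpret Q: ring Q by (rule ring_Q)
  have IH: "partial_hom l (\<lambda>a. \<Oplus>\<^bsub>R\<^esub>i\<in>F. f i a)"
    "(\<Oplus>\<^bsub>Q\<^esub>i\<in>F. qc l (f i)) = qc l (\<lambda>a. \<Oplus>\<^bsub>R\<^esub>i\<in>F. f i a)"
    using insert by auto
  have fi: "partial_hom l (f i)" and F: "\<And>j. j \<in> F \<Longrightarrow> partial_hom l (f j)" using insert by auto
  have eq: "f i a \<oplus>\<^bsub>R\<^esub> (\<Oplus>\<^bsub>R\<^esub>i\<in>F. f i a) = (\<Oplus>\<^bsub>R\<^esub>i\<in>insert i F. f i a)" if "a \<in> P l" for a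
    using insert.hyps that fi F partial_hom_closed
    by (subst R.finsum_insert) auto
  note plus = partial_hom_plus[OF fi IH(1)]
  have "(\<Oplus>\<^bsub>Q\<^esub>j\<in>insert i F. qc l (f j)) = qc l (f i) \<oplus>\<^bsub>Q\<^esub> (\<Oplus>\<^bsub>Q\<^esub>j\<in>F. qc l (f j))"
    using insert.hyps fi F by (subst Q.finsum_insert) auto
  also have "\<dots> = qc l (\<lambda>a. f i a \<oplus>\<^bsub>R\<^esub> (\<Oplus>\<^bsub>R\<^esub>i\<in>F. f i a))"
    unfolding IH(2) by (rule quot_class_add[OF fi IH(1)])
  also have "\<dots> = qc l (\<lambda>a. \<Oplus>\<^bsub>R\<^esub>i\<in>insert i F. f i a)"
    by (rule quot_class_cong[OF plus eq])
  finally have "(\<Oplus>\<^bsub>Q\<^esub>j\<in>insert i F. qc l (f j)) = qc l (\<lambda>a. \<Oplus>\<^bsub>R\<^esub>i\<in>insert i F. f i a)" .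
  moreover have "partial_hom l (\<lambda>a. f i a \<oplus>\<^bsub>R\<^esub> (\<Oplus>\<^bsub>R\<^esub>i\<in>F. f i a)) \<longleftrightarrow>
    partial_hom l (\<lambda>a. \<Oplus>\<^bsub>R\<^esub>i\<in>insert i F. f i a)"
    by (rule partial_hom_cong) (rule eq)
  ultimately show ?case using plus by simp
qed

end


section \<open>Ideals that are free on a row\<close>

lemma (in ring) right_idealD:
  assumes "right_ideal J R"
  shows "J \<subseteq> carrier R" "\<zero> \<in> J" "\<And>a b. a \<in> J \<Longrightarrow> b \<in> J \<Longrightarrow> a \<oplus> b \<in> J"
    "\<And>a r. a \<in> J \<Longrightarrow> r \<in> carrier R \<Longrightarrow> a \<otimes> r \<in> J"
proof -
  interpret additive_subgroup J R using assms by (simp add: right_ideal_def)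
  show "J \<subseteq> carrier R" "\<zero> \<in> J" "\<And>a b. a \<in> J \<Longrightarrow> b \<in> J \<Longrightarrow> a \<oplus> b \<in> J"
    by (rule a_subset zero_closed a_closed; assumption)+
qed (use assms in \<open>simp add: right_ideal_def\<close>)

text \<open>Closure under negation comes from right multiplication by
  \<open>\<ominus> \<one>\<close>.\<close>

lemma (in ring) right_idealI:
  assumes "J \<subseteq> carrier R" "\<zero> \<in> J" "\<And>a b. a \<in> J \<Longrightarrow> b \<in> J \<Longrightarrow> a \<oplus> b \<in> J"
    "\<And>a r. a \<in> J \<Longrightarrow> r \<in> carrier R \<Longrightarrow> a \<otimes> r \<in> J"
  shows "right_ideal J R"
proof -
  have "\<ominus> a \<in> J" if "a \<in> J" for a
    using assms(4)[OF that, of "\<ominus> \<one>"] assms(1) that by (simp add: r_minus subset_iff)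
  then have "subgroup J (add_monoid R)"
    using assms by (intro add.subgroupI) (auto simp: a_inv_def)
  then show ?thesis
    using assms(4) by (simp add: right_ideal_def additive_subgroup_def)
qed

lemma (in ring) right_ideal_inter:
  "right_ideal J R \<Longrightarrow> right_ideal J' R \<Longrightarrow> right_ideal (J \<inter> J') R"
  by (rule right_idealI) (auto dest: right_idealD)

lemma (in ring) right_ideal_colon:
  assumes J: "right_ideal J R" and a: "a \<in> carrier R"
  shows "right_ideal (colon R J a) R"
  by (rule right_idealI)
    (use right_idealD[OF J] a in \<open>auto simp: colon_def r_distr simp flip: m_assoc\<close>)

lemma (in ring) right_ideal_finsum:
  assumes "right_ideal J R" "finite A" "\<And>i. i \<in> A \<Longrightarrow> f i \<in> J"
  shows "(\<Oplus>i\<in>A. f i) \<in> J"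
  using assms(2,3)
proof (induction rule: finite_induct)
  case (insert i F)
  then show ?case
    using right_idealD[OF assms(1)] by (subst finsum_insert) auto
qed (simp add: right_idealD[OF assms(1)])

section \<open>Coordinates on an ideal that is free on the row\<close>

locale leavitt_free = leavitt_row K R n x
  for K :: "('k, 's) ring_scheme" (structure) and R :: "('k, 'a, 't) module_scheme" (structure)
    and n :: nat and x :: "nat \<Rightarrow> 'a" +
  assumes ideal: "ideal (right_span R n x) R"
    and free: "free_right_module_on R n x (right_span R n x)"
    and annihilator: "trivial_left_annihilator R (right_span R n x)"
begin

abbreviation I where "I \<equiv> right_span R n x"

sublocale ideal_adic K R I
  by (rule ideal_adic.intro[OF assoc_algebra ideal])

lemma x_I: "i \<in> {1..n} \<Longrightarrow> x i \<in> I"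
  by (rule R.mem_right_span[OF x_funcset])

text \<open>Here the extra factor of \<open>I\<close> stands on the left, whereas
  \<open>P_Suc\<close> adds it on the right; hence the detour through \<open>P_plus\<close>. It lets
  multiplication by \<open>x i\<close> lower the level in the later inductions.\<close>

lemma x_mult_P: "i \<in> {1..n} \<Longrightarrow> a \<in> P l \<Longrightarrow> x i \<otimes>\<^bsub>R\<^esub> a \<in> P (Suc l)"
  using P_plus[of 1 l] ideal_prod.prod[of "x i" I a "P l" R] x_I P_1 by simp

text \<open>The dual basis as total functions, meaningful on \<open>I\<close> only. An explicit
  inverse of the coefficient map is easier to handle than the description in
  \<open>dual_hom\<close>, with which it is identified in \<open>dual_hom_eq\<close>.\<close>

definition coord :: "nat \<Rightarrow> 'a \<Rightarrow> 'a"
  where "coord i a = inv_into ({1..n} \<rightarrow>\<^sub>E carrier R) (right_comb R n x) a i"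

lemma coord_closed:
  assumes "a \<in> I" "i \<in> {1..n}"
  shows "coord i a \<in> carrier R"
proof -
  have "inv_into ({1..n} \<rightarrow>\<^sub>E carrier R) (right_comb R n x) a \<in> {1..n} \<rightarrow>\<^sub>E carrier R"
    using assms(1) by (intro inv_into_into) (simp add: right_span_def)
  then show ?thesis unfolding coord_def using assms(2) by (rule PiE_mem)
qed

lemma right_comb_coord:
  assumes "a \<in> I"
  shows "right_comb R n x (\<lambda>i. coord i a) = a"
proof -
  have "right_comb R n x (inv_into ({1..n} \<rightarrow>\<^sub>E carrier R) (right_comb R n x) a) = a"
    using f_inv_into_f[of a "right_comb R n x" "{1..n} \<rightarrow>\<^sub>E carrier R"] assms
    by (simp add: right_span_def)
  then show ?thesis by (simp add: coord_def)
qed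

lemma coord_right_comb:
  assumes s: "s \<in> {1..n} \<rightarrow> carrier R" and i: "i \<in> {1..n}"
  shows "coord i (right_comb R n x s) = s i"
proof -
  have "inv_into ({1..n} \<rightarrow>\<^sub>E carrier R) (right_comb R n x) (right_comb R n x (restrict s {1..n}))
    = restrict s {1..n}"
    using free s by (intro inv_into_f_f) (auto simp: free_right_module_on_def bij_betw_def)
  then show ?thesis
    using i unfolding coord_def right_comb_restrict[OF R.ring_axioms x_funcset s] by simp
qed

lemma right_comb_add:
  assumes "s \<in> {1..n} \<rightarrow> carrier R" "t \<in> {1..n} \<rightarrow> carrier R"
  shows "right_comb R n x s \<oplus>\<^bsub>R\<^esub> right_comb R n x t = right_comb R n x (\<lambda>i. s i \<oplus>\<^bsub>R\<^esub> t i)"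
proof -
  have "right_comb R n x s \<oplus>\<^bsub>R\<^esub> right_comb R n x t
    = (\<Oplus>\<^bsub>R\<^esub>i\<in>{1..n}. x i \<otimes>\<^bsub>R\<^esub> s i \<oplus>\<^bsub>R\<^esub> x i \<otimes>\<^bsub>R\<^esub> t i)"
    unfolding right_comb_def using assms x_funcset
    by (intro R.finsum_addf[symmetric]) (auto simp: Pi_iff)
  also have "\<dots> = right_comb R n x (\<lambda>i. s i \<oplus>\<^bsub>R\<^esub> t i)"
    unfolding right_comb_def using assms x_funcset
    by (intro R.finsum_cong') (auto simp: Pi_iff R.r_distr)
  finally show ?thesis .
qed

lemma right_comb_mult:
  assumes "s \<in> {1..n} \<rightarrow> carrier R" "r \<in> carrier R"
  shows "right_comb R n x s \<otimes>\<^bsub>R\<^esub> r = right_comb R n x (\<lambda>i. s i \<otimes>\<^bsub>R\<^esub> r)"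
proof -
  have "right_comb R n x s \<otimes>\<^bsub>R\<^esub> r = (\<Oplus>\<^bsub>R\<^esub>i\<in>{1..n}. x i \<otimes>\<^bsub>R\<^esub> s i \<otimes>\<^bsub>R\<^esub> r)"
    unfolding right_comb_def using assms x_funcset
    by (intro R.finsum_ldistr) (auto simp: Pi_iff)
  also have "\<dots> = right_comb R n x (\<lambda>i. s i \<otimes>\<^bsub>R\<^esub> r)"
    unfolding right_comb_def using assms x_funcset
    by (intro R.finsum_cong') (auto simp: Pi_iff R.m_assoc)
  finally show ?thesis .
qed

text \<open>Combinations are added and multiplied on the right coefficientwise, and freeness makes
  the coefficients unique.\<close>

lemma partial_hom_coord:
  assumes i: "i \<in> {1..n}"
  shows "partial_hom 1 (coord i)"
  unfolding partial_hom_def P_1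
proof (intro conjI ballI)
  show "coord i \<in> I \<rightarrow> carrier R" using coord_closed i by blast
  have c: "(\<lambda>i. coord i a) \<in> {1..n} \<rightarrow> carrier R" if "a \<in> I" for a
    using coord_closed that by blast
  fix a assume a: "a \<in> I"
  show "coord i (a \<oplus>\<^bsub>R\<^esub> b) = coord i a \<oplus>\<^bsub>R\<^esub> coord i b" if b: "b \<in> I" for b
  proof -
    have "a \<oplus>\<^bsub>R\<^esub> b = right_comb R n x (\<lambda>i. coord i a \<oplus>\<^bsub>R\<^esub> coord i b)"
      using right_comb_add[OF c[OF a] c[OF b]] a b by (simp add: right_comb_coord)
    then show ?thesis using c[OF a] c[OF b] i by (simp add: coord_right_comb Pi_iff)
  qed
  show "coord i (a \<otimes>\<^bsub>R\<^esub> r) = coord i a \<otimes>\<^bsub>R\<^esub> r" if r: "r \<in> carrier R" for r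
  proof -
    have "a \<otimes>\<^bsub>R\<^esub> r = right_comb R n x (\<lambda>i. coord i a \<otimes>\<^bsub>R\<^esub> r)"
      using right_comb_mult[OF c[OF a] r] a by (simp add: right_comb_coord)
    then show ?thesis using c[OF a] r i by (simp add: coord_right_comb Pi_iff)
  qed
qed

lemma coord_x:
  assumes "i \<in> {1..n}" "j \<in> {1..n}"
  shows "coord i (x j) = (if i = j then \<one>\<^bsub>R\<^esub> else \<zero>\<^bsub>R\<^esub>)"
proof -
  let ?e = "\<lambda>i. if i = j then \<one>\<^bsub>R\<^esub> else \<zero>\<^bsub>R\<^esub>"
  have "right_comb R n x ?e = (\<Oplus>\<^bsub>R\<^esub>i\<in>{1..n}. if j = i then x i else \<zero>\<^bsub>R\<^esub>)"
    unfolding right_comb_def using x_funcset by (intro R.finsum_cong') (auto simp: Pi_iff)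
  also have "\<dots> = x j" using assms x_funcset by (intro R.finsum_singleton) auto
  finally show ?thesis using coord_right_comb[of ?e i] assms by simp
qed

text \<open>A homomorphism on \<open>I\<close> is thus determined by its values on the
  \<open>x i\<close>, which yields the uniqueness required by \<open>dual_hom\<close>.\<close>

lemma partial_hom_right_comb:
  assumes \<phi>: "partial_hom 1 \<phi>" and s: "s \<in> {1..n} \<rightarrow> carrier R"
  shows "\<phi> (right_comb R n x s) = right_comb R n (\<lambda>i. \<phi> (x i)) s"
proof -
  have x: "x i \<otimes>\<^bsub>R\<^esub> s i \<in> P 1" "x i \<in> P 1" if "i \<in> {1..n}" for i
    using x_I[OF that] funcset_mem[OF s that] P_1
    by (simp_all add: P_mult_right[of "x i" 1, unfolded P_1])
  have "\<phi> (right_comb R n x s) = (\<Oplus>\<^bsub>R\<^esub>i\<in>{1..n}. \<phi> (x i \<otimes>\<^bsub>R\<^esub> s i))"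
    unfolding right_comb_def using partial_hom_finsum[OF \<phi>, of "{1..n}" "\<lambda>i. x i \<otimes>\<^bsub>R\<^esub> s i"] x
    by auto
  also have "\<dots> = right_comb R n (\<lambda>i. \<phi> (x i)) s"
    unfolding right_comb_def using x s partial_hom_closed[OF \<phi>] partial_hom_mult[OF \<phi>]
    by (intro R.finsum_cong') (auto simp: Pi_iff)
  finally show ?thesis .
qed

lemma dual_hom_eq:
  assumes i: "i \<in> {1..n}"
  shows "dual_hom R n x i = restrict (coord i) I"
  unfolding dual_hom_def
proof (rule the_equality)
  show "restrict (coord i) I \<in> right_module_hom R I \<and>
      (\<forall>j\<in>{1..n}. restrict (coord i) I (x j) = (if i = j then \<one>\<^bsub>R\<^esub> else \<zero>\<^bsub>R\<^esub>))"
    using right_module_hom_iff[of "restrict (coord i) I" 1] partial_hom_restrict[of 1 "coord i"]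
      partial_hom_coord[OF i] coord_x[OF i] x_I by (simp add: P_1[simplified])
  fix \<phi> assume \<phi>: "\<phi> \<in> right_module_hom R I \<and>
      (\<forall>j\<in>{1..n}. \<phi> (x j) = (if i = j then \<one>\<^bsub>R\<^esub> else \<zero>\<^bsub>R\<^esub>))"
  then have hom: "partial_hom 1 \<phi>" and ext: "\<phi> \<in> extensional I"
    using right_module_hom_iff[of \<phi> 1] P_1 by auto
  have "\<phi> a = coord i a" if a: "a \<in> I" for a
  proof -
    have s: "(\<lambda>i. coord i a) \<in> {1..n} \<rightarrow> carrier R" using coord_closed[OF a] by blast
    have "right_comb R n (\<lambda>j. \<phi> (x j)) (\<lambda>i. coord i a)
      = right_comb R n (\<lambda>j. coord i (x j)) (\<lambda>i. coord i a)"
      unfolding right_comb_def using \<phi> s i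
      by (intro R.finsum_cong') (auto simp: coord_x Pi_iff)
    then show ?thesis
      using partial_hom_right_comb[OF hom s] partial_hom_right_comb[OF partial_hom_coord[OF i] s]
      by (simp add: right_comb_coord[OF a])
  qed
  then show "\<phi> = restrict (coord i) I"
    using ext by (intro extensionalityI[of _ I]) auto
qed

section \<open>The inverse column over \<open>Q(R)\<close> and the induced homomorphism\<close>

abbreviation qm where "qm \<equiv> quotient_map R I"
abbreviation qstar where "qstar \<equiv> quotient_star R n x"

sublocale Q: ring Q
  by (rule ring_Q)

lemma qm_ring_hom: "qm \<in> ring_hom R Q"
  using quotient_map_hom by (simp add: alg_hom_def)

sublocale qm: ring_hom_ring R Q qm
  by (rule ring_hom_ringI2) (rule R.ring_axioms ring_Q qm_ring_hom)+

lemma qstar_eq: "i \<in> {1..n} \<Longrightarrow> qstar i = qc 1 (coord i)"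
  unfolding quotient_star_def by (simp add: dual_hom_eq quot_class_def P_1[simplified])

lemma qstar_funcset: "qstar \<in> {1..n} \<rightarrow> carrier Q"
  using partial_hom_coord by (simp add: qstar_eq)

lemma qm_x_funcset: "(\<lambda>i. qm (x i)) \<in> {1..n} \<rightarrow> carrier Q"
  using x_closed by auto

text \<open>The product is represented by \<open>a \<mapsto> coord i (x j \<otimes> a)\<close>.
  Right linearity takes \<open>a\<close> out, leaving the identity or zero.\<close>

lemma qstar_qm_x:
  assumes i: "i \<in> {1..n}" and j: "j \<in> {1..n}"
  shows "qstar i \<otimes>\<^bsub>Q\<^esub> qm (x j) = (if i = j then \<one>\<^bsub>Q\<^esub> else \<zero>\<^bsub>Q\<^esub>)"
proof -
  have xj: "x j \<in> carrier R" "x j \<in> P 1" using j x_closed x_I P_1 by auto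
  have comp: "partial_hom (1 + 0) (\<lambda>a. coord i (x j \<otimes>\<^bsub>R\<^esub> a))"
    by (rule partial_hom_comp[OF partial_hom_coord[OF i] partial_hom_left_mult[OF xj(1)]])
  have "qstar i \<otimes>\<^bsub>Q\<^esub> qm (x j) = qc (1 + 0) (\<lambda>a. coord i (x j \<otimes>\<^bsub>R\<^esub> a))"
    unfolding qstar_eq[OF i] quotient_map_eq[OF xj(1), of 0]
    by (rule quot_class_mult[OF partial_hom_coord[OF i] partial_hom_left_mult[OF xj(1)]])
  also have "\<dots> = qc (1 + 0) (\<lambda>a. if i = j then a else \<zero>\<^bsub>R\<^esub>)"
    using comp
  proof (rule quot_class_cong)
    fix a assume "a \<in> P (1 + 0)"
    then have "a \<in> carrier R" by (rule P_carrier)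
    then show "coord i (x j \<otimes>\<^bsub>R\<^esub> a) = (if i = j then a else \<zero>\<^bsub>R\<^esub>)"
      using partial_hom_mult[OF partial_hom_coord[OF i] xj(2), of a] i j by (simp add: coord_x)
  qed
  also have "\<dots> = (if i = j then \<one>\<^bsub>Q\<^esub> else \<zero>\<^bsub>Q\<^esub>)"
    by (simp add: Q_one[of 1] Q_zero[of 1])
  finally show ?thesis .
qed

text \<open>The sum is represented on \<open>I\<close> by expanding an element in the
  \<open>x i\<close>, hence by the identity of \<open>P 1\<close>, which represents one.\<close>

lemma qm_x_qstar_sum: "(\<Oplus>\<^bsub>Q\<^esub>i\<in>{1..n}. qm (x i) \<otimes>\<^bsub>Q\<^esub> qstar i) = \<one>\<^bsub>Q\<^esub>"
proof -
  have comp: "partial_hom 1 (\<lambda>a. x i \<otimes>\<^bsub>R\<^esub> coord i a)" if i: "i \<in> {1..n}" for i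
    using partial_hom_comp[OF partial_hom_left_mult[OF x_closed[OF i], of 0]
        partial_hom_coord[OF i]]
    by simp
  have "(\<Oplus>\<^bsub>Q\<^esub>i\<in>{1..n}. qm (x i) \<otimes>\<^bsub>Q\<^esub> qstar i)
    = (\<Oplus>\<^bsub>Q\<^esub>i\<in>{1..n}. qc 1 (\<lambda>a. x i \<otimes>\<^bsub>R\<^esub> coord i a))"
  proof (rule Q.finsum_cong')
    fix i assume i: "i \<in> {1..n}"
    show "qm (x i) \<otimes>\<^bsub>Q\<^esub> qstar i = qc 1 (\<lambda>a. x i \<otimes>\<^bsub>R\<^esub> coord i a)"
      unfolding qstar_eq[OF i] quotient_map_eq[OF x_closed[OF i], of 0]
      using quot_class_mult[OF partial_hom_left_mult[OF x_closed[OF i], of 0]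
          partial_hom_coord[OF i]]
      by simp
  qed (use comp in auto)
  also have "\<dots> = qc 1 (\<lambda>a. \<Oplus>\<^bsub>R\<^esub>i\<in>{1..n}. x i \<otimes>\<^bsub>R\<^esub> coord i a)"
    using comp by (intro conjunct2[OF quot_class_finsum]) auto
  also have "\<dots> = qc 1 (\<lambda>a. a)"
  proof (rule quot_class_cong)
    show "partial_hom 1 (\<lambda>a. \<Oplus>\<^bsub>R\<^esub>i\<in>{1..n}. x i \<otimes>\<^bsub>R\<^esub> coord i a)"
      using comp by (intro conjunct1[OF quot_class_finsum]) auto
    show "(\<Oplus>\<^bsub>R\<^esub>i\<in>{1..n}. x i \<otimes>\<^bsub>R\<^esub> coord i a) = a" if "a \<in> P 1" for a
      using right_comb_coord[of a] that P_1 by (simp add: right_comb_def)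
  qed
  also have "\<dots> = \<one>\<^bsub>Q\<^esub>" by (rule Q_one[symmetric])
  finally show ?thesis .
qed

theorem induced_hom_unique: "\<exists>!f. f \<in> induced_homs K R n x"
  using leavitt_universal[OF assoc_algebra_Q quotient_map_hom qstar_funcset qstar_qm_x
      qm_x_qstar_sum]
  by (simp add: induced_homs_def)

section \<open>The Gabriel topology\<close>

lemma adic_topology_iff: "J \<in> adic_topology R I \<longleftrightarrow> right_ideal J R \<and> (\<exists>l. P l \<subseteq> J)"
  by (simp add: adic_topology_def)

text \<open>The hypothesis passes from \<open>J\<close> at level \<open>Suc l\<close> to
  \<open>(J : x i)\<close> at level \<open>l\<close>, because \<open>((J : x i) : a)\<close> is
  \<open>(J : x i a)\<close> and \<open>x i a\<close> lies in \<open>P (Suc l)\<close>.\<close>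

lemma adic_local_character:
  assumes "right_ideal J R" "\<And>a. a \<in> P l \<Longrightarrow> \<exists>m. P m \<subseteq> colon R J a"
  shows "\<exists>p. P p \<subseteq> J"
  using assms
proof (induction l arbitrary: J)
  case 0
  \<comment> \<open>\<open>P 0\<close> contains \<open>\<one>\<close>, and \<open>(J : 1)\<close> is
    \<open>J\<close> itself.\<close>
  then obtain m where m: "P m \<subseteq> colon R J \<one>\<^bsub>R\<^esub>" by force
  have "P m \<subseteq> J" using m by (auto simp: colon_def)
  then show ?case by blast
next
  case (Suc l)
  have "\<exists>p. P p \<subseteq> colon R J (x i)" if i: "i \<in> {1..n}" for i
  proof (rule Suc.IH)
    show "right_ideal (colon R J (x i)) R"
      by (rule R.right_ideal_colon[OF Suc.prems(1) x_closed[OF i]])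
    fix a assume a: "a \<in> P l"
    obtain m where "P m \<subseteq> colon R J (x i \<otimes>\<^bsub>R\<^esub> a)" using Suc.prems(2)[OF x_mult_P[OF i a]] by blast
    then have "P m \<subseteq> colon R (colon R J (x i)) a"
      using x_closed[OF i] P_carrier[OF a] by (auto simp: colon_def R.m_assoc subset_iff)
    then show "\<exists>m. P m \<subseteq> colon R (colon R J (x i)) a" by blast
  qed
  then obtain p where p: "\<And>i. i \<in> {1..n} \<Longrightarrow> P (p i) \<subseteq> colon R J (x i)" by metis
  \<comment> \<open>One exponent above all \<open>p i\<close>. Coordinates of elements of
    \<open>P (Suc q)\<close> lie in \<open>P q\<close>, so each term
    \<open>x i \<otimes> coord i a\<close> falls into \<open>J\<close>.\<close>
  define q where "q = (\<Sum>i\<in>{1..n}. p i)"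
  have "a \<in> J" if a: "a \<in> P (Suc q)" for a
  proof -
    have aI: "a \<in> I" using a P_antimono[of 1 "Suc q"] P_1 by auto
    have "x i \<otimes>\<^bsub>R\<^esub> coord i a \<in> J" if i: "i \<in> {1..n}" for i
    proof -
      have "coord i a \<in> P q"
        by (rule partial_hom_shift[OF partial_hom_coord[OF i], of 1]) (use a in auto)
      moreover have "p i \<le> q" unfolding q_def using i by (intro member_le_sum) auto
      ultimately have "coord i a \<in> colon R J (x i)" using p[OF i] P_antimono by blast
      then show ?thesis by (simp add: colon_def)
    qed
    then have "right_comb R n x (\<lambda>i. coord i a) \<in> J"
      unfolding right_comb_def by (intro R.right_ideal_finsum[OF Suc.prems(1)]) auto
    then show ?thesis using right_comb_coord[OF aI] by simp
  qed
  then show ?case by blast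
qed

theorem gabriel_adic: "gabriel_topology R (adic_topology R I)"
  unfolding gabriel_topology_def
proof (intro conjI ballI allI impI)
  show "adic_topology R I \<noteq> {}"
    using right_ideal_P adic_topology_iff by (metis empty_iff order.refl)
next
  fix J assume J: "J \<in> adic_topology R I"
  then show "right_ideal J R" by (simp add: adic_topology_iff)
  obtain l where l: "P l \<subseteq> J" using J by (auto simp: adic_topology_iff)
  show "J' \<in> adic_topology R I" if "right_ideal J' R" "J \<subseteq> J'" for J'
    using that l by (auto simp: adic_topology_iff)
  show "J \<inter> J' \<in> adic_topology R I" if J': "J' \<in> adic_topology R I" for J'
  proof -
    obtain m where m: "P m \<subseteq> J'" using J' by (auto simp: adic_topology_iff)
    have "P (l + m) \<subseteq> J \<inter> J'"
      using l m P_antimono[of l "l + m"] P_antimono[of m "l + m"] by auto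
    then show ?thesis using J J' R.right_ideal_inter by (auto simp: adic_topology_iff)
  qed
  show "colon R J a \<in> adic_topology R I" if a: "a \<in> carrier R" for a
  proof -
    \<comment> \<open>The power is a two-sided ideal, so left multiplication by \<open>a\<close>
      keeps it inside \<open>J\<close>.\<close>
    have "P l \<subseteq> colon R J a" using l a P_mult_left[of _ l a] P_carrier by (auto simp: colon_def)
    then show ?thesis using J R.right_ideal_colon[OF _ a] by (auto simp: adic_topology_iff)
  qed
next
  fix J assume J: "right_ideal J R"
    and "\<exists>J'\<in>adic_topology R I. \<forall>a\<in>J'. colon R J a \<in> adic_topology R I"
  then obtain J' l where J': "P l \<subseteq> J'" "\<forall>a\<in>J'. colon R J a \<in> adic_topology R I"
    by (auto simp: adic_topology_iff)
  have "\<exists>p. P p \<subseteq> J"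
    using J by (rule adic_local_character[of _ l]) (use J' in \<open>auto simp: adic_topology_iff\<close>)
  then show "J \<in> adic_topology R I" using J by (simp add: adic_topology_iff)
qed

section \<open>Injectivity of the induced homomorphism\<close>

text \<open>Factors of \<open>I\<close> are peeled off on the right: for \<open>a\<close> in
  \<open>P p\<close>, the element \<open>r a\<close> annihilates \<open>I\<close> and so vanishes.
  At exponent 0 this reaches \<open>r\<close> times \<open>\<one>\<close>.\<close>

lemma annihilator_P:
  assumes r: "r \<in> carrier R" and "\<And>a. a \<in> P p \<Longrightarrow> r \<otimes>\<^bsub>R\<^esub> a = \<zero>\<^bsub>R\<^esub>"
  shows "r = \<zero>\<^bsub>R\<^esub>"
  using assms(2)
proof (induction p)
  case 0
  then show ?case using r R.r_one[OF r] by (metis P_0 R.one_closed)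
next
  case (Suc p)
  show ?case
  proof (rule Suc.IH)
    fix a assume a: "a \<in> P p"
    have "(r \<otimes>\<^bsub>R\<^esub> a) \<otimes>\<^bsub>R\<^esub> b = \<zero>\<^bsub>R\<^esub>" if b: "b \<in> I" for b
    proof -
      have "a \<otimes>\<^bsub>R\<^esub> b \<in> P (Suc p)" unfolding P_Suc by (rule ideal_prod.prod[OF a b])
      then show ?thesis
        using Suc.prems r P_carrier[OF a] ideal.Icarr[OF ideal b] by (simp add: R.m_assoc)
    qed
    then show "r \<otimes>\<^bsub>R\<^esub> a = \<zero>\<^bsub>R\<^esub>"
      using annihilator r P_carrier[OF a] by (simp add: trivial_left_annihilator_def)
  qed
qed

lemma qm_kernel:
  assumes r: "r \<in> carrier R" and "qm r = \<zero>\<^bsub>Q\<^esub>"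
  shows "r = \<zero>\<^bsub>R\<^esub>"
proof -
  have "qc 0 (\<lambda>a. r \<otimes>\<^bsub>R\<^esub> a) = qc 0 (\<lambda>a. \<zero>\<^bsub>R\<^esub>)"
    using assms by (simp add: quotient_map_eq[of r 0] Q_zero[of 0])
  then obtain p where "\<And>a. a \<in> P p \<Longrightarrow> r \<otimes>\<^bsub>R\<^esub> a = \<zero>\<^bsub>R\<^esub>"
    using partial_hom_left_mult[OF r] partial_hom_const_zero by (rule quot_class_eqD) blast
  then show ?thesis by (rule annihilator_P[OF r])
qed

text \<open>Every element of \<open>L(R)\<close> lies in some conductor; \<open>l\<close> is the induction parameter for the
  injectivity of \<open>f\<close>.\<close>

definition conductor :: "nat \<Rightarrow> ('k, 'a) leavitt_term set set"
  where "conductor l = {y \<in> carrier L. \<forall>a\<in>P l. y \<otimes>\<^bsub>L\<^esub> \<iota> a \<in> \<iota> ` carrier R}"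

lemma conductor_mono: "l \<le> m \<Longrightarrow> conductor l \<subseteq> conductor m"
  using P_antimono[of l m] by (auto simp: conductor_def)

text \<open>The analogue in \<open>L\<close> of \<open>partial_hom_shift\<close>: on a product
  \<open>b c\<close> the factor \<open>b\<close> absorbs \<open>y\<close> into the image of
  \<open>R\<close>, and \<open>c\<close> stays in the left ideal \<open>P l\<close>.\<close>

lemma conductor_shift:
  assumes y: "y \<in> conductor m" and a: "a \<in> P (m + l)"
  shows "y \<otimes>\<^bsub>L\<^esub> \<iota> a \<in> \<iota> ` P l"
proof -
  have yL: "y \<in> carrier L" using y by (simp add: conductor_def)
  have sub: "P m \<cdot>\<^bsub>R\<^esub> P l \<subseteq> carrier R" by (rule R.ideal_prod_in_carrier[OF ideal_P ideal_P])
  have "a \<in> P m \<cdot>\<^bsub>R\<^esub> P l" using a by (simp add: P_plus)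
  then show ?thesis
  proof (induction rule: ideal_prod.induct)
    case (prod b c)
    then obtain r where r: "r \<in> carrier R" "y \<otimes>\<^bsub>L\<^esub> \<iota> b = \<iota> r" using y by (auto simp: conductor_def)
    have "y \<otimes>\<^bsub>L\<^esub> \<iota> (b \<otimes>\<^bsub>R\<^esub> c) = (y \<otimes>\<^bsub>L\<^esub> \<iota> b) \<otimes>\<^bsub>L\<^esub> \<iota> c"
      using P_carrier[OF prod(1)] P_carrier[OF prod(2)] yL by (simp add: L.m_assoc)
    also have "\<dots> = \<iota> (r \<otimes>\<^bsub>R\<^esub> c)" using r P_carrier[OF prod(2)] by simp
    finally show ?case using P_mult_left[OF prod(2) r(1)] by blast
  next
    case (sum b c)
    then obtain b' c' where bc: "b' \<in> P l" "y \<otimes>\<^bsub>L\<^esub> \<iota> b = \<iota> b'" "c' \<in> P l" "y \<otimes>\<^bsub>L\<^esub> \<iota> c = \<iota> c'"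
      by blast
    have "y \<otimes>\<^bsub>L\<^esub> \<iota> (b \<oplus>\<^bsub>R\<^esub> c) = \<iota> b' \<oplus>\<^bsub>L\<^esub> \<iota> c'"
      using sum(1,2) sub yL bc(2,4) by (simp add: L.r_distr subset_iff)
    also have "\<dots> = \<iota> (b' \<oplus>\<^bsub>R\<^esub> c')" using bc P_carrier by simp
    finally show ?case using P_add[OF bc(1,3)] by blast
  qed
qed

text \<open>Elements of \<open>R\<close> have level 0 and the starred generators level 1. Sums and
  products add levels; negation and scalars preserve them.\<close>

lemma conductor_exhausts: "wf s \<Longrightarrow> \<exists>l. cls s \<in> conductor l"
proof (induction s)
  case (Base r)
  have "cls (Base r) \<in> conductor 0"
    using Base by (auto simp: conductor_def leavitt_map_def[symmetric] simp flip: \<iota>.hom_mult)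
  then show ?case by blast
next
  case (Star i)
  have "star i \<otimes>\<^bsub>L\<^esub> \<iota> a \<in> \<iota> ` carrier R" if a: "a \<in> I" for a
  proof -
    obtain s where s: "s \<in> {1..n} \<rightarrow> carrier R" "a = right_comb R n x s"
      using a right_span_iff[OF R.ring_axioms x_funcset] by blast
    then show ?thesis using Star star_\<iota>_right_comb[of s i] by auto
  qed
  then have "cls (Star i) \<in> conductor 1"
    using Star P_1 by (simp add: conductor_def leavitt_star_def)
  then show ?case by blast
next
  case (Plus s t)
  then obtain l m where "cls s \<in> conductor l" "cls t \<in> conductor m" by auto
  then have st: "cls s \<in> conductor (l + m)" "cls t \<in> conductor (l + m)"
    using conductor_mono[of l "l + m"] conductor_mono[of m "l + m"] by auto
  have "(cls s \<oplus>\<^bsub>L\<^esub> cls t) \<otimes>\<^bsub>L\<^esub> \<iota> a \<in> \<iota> ` carrier R" if a: "a \<in> P (l + m)" for a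
  proof -
    obtain b c where bc: "b \<in> carrier R" "cls s \<otimes>\<^bsub>L\<^esub> \<iota> a = \<iota> b"
      "c \<in> carrier R" "cls t \<otimes>\<^bsub>L\<^esub> \<iota> a = \<iota> c"
      using st a unfolding conductor_def by blast
    then have "(cls s \<oplus>\<^bsub>L\<^esub> cls t) \<otimes>\<^bsub>L\<^esub> \<iota> a = \<iota> (b \<oplus>\<^bsub>R\<^esub> c)"
      using Plus.prems P_carrier[OF a] by (simp add: L.l_distr)
    then show ?thesis using bc by blast
  qed
  then have "cls s \<oplus>\<^bsub>L\<^esub> cls t \<in> conductor (l + m)" using Plus.prems by (simp add: conductor_def)
  then show ?case using Plus.prems by (auto simp: class_Plus)
next
  case (Times s t)
  then obtain l m where st: "cls s \<in> conductor l" "cls t \<in> conductor m" by auto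
  \<comment> \<open>The right factor acts first and brings \<open>P (m + l)\<close> into
    \<open>P l\<close>, where the condition on the left factor applies.\<close>
  have "(cls s \<otimes>\<^bsub>L\<^esub> cls t) \<otimes>\<^bsub>L\<^esub> \<iota> a \<in> \<iota> ` carrier R" if a: "a \<in> P (m + l)" for a
  proof -
    obtain b where "b \<in> P l" "cls t \<otimes>\<^bsub>L\<^esub> \<iota> a = \<iota> b" using conductor_shift[OF st(2) a] by blast
    then show ?thesis
      using st(1) Times.prems P_carrier[OF a] by (simp add: L.m_assoc conductor_def)
  qed
  then have "cls s \<otimes>\<^bsub>L\<^esub> cls t \<in> conductor (m + l)" using Times.prems by (simp add: conductor_def)
  then show ?case using Times.prems by (auto simp: class_Times)
next
  case (Minus s)
  then obtain l where s: "cls s \<in> conductor l" by auto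
  have "cls (Minus s) \<oplus>\<^bsub>L\<^esub> cls s = \<zero>\<^bsub>L\<^esub>"
    using Minus.prems by (simp add: class_Plus L_zero class_eqI[OF le_add_minus])
  then have eq: "cls (Minus s) = \<ominus>\<^bsub>L\<^esub> cls s"
    using Minus.prems by (intro L.minus_equality[symmetric]) auto
  have "(\<ominus>\<^bsub>L\<^esub> cls s) \<otimes>\<^bsub>L\<^esub> \<iota> a \<in> \<iota> ` carrier R" if a: "a \<in> P l" for a
  proof -
    obtain b where b: "b \<in> carrier R" "cls s \<otimes>\<^bsub>L\<^esub> \<iota> a = \<iota> b"
      using s a unfolding conductor_def by blast
    then have "(\<ominus>\<^bsub>L\<^esub> cls s) \<otimes>\<^bsub>L\<^esub> \<iota> a = \<iota> (\<ominus>\<^bsub>R\<^esub> b)"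
      using Minus.prems P_carrier[OF a] by (simp add: L.l_minus)
    then show ?thesis using b by blast
  qed
  then have "cls (Minus s) \<in> conductor l" using Minus.prems by (simp add: conductor_def eq)
  then show ?case by blast
next
  case (Scale c s)
  then obtain l where s: "cls s \<in> conductor l" by auto
  have "cls (Scale c s) \<otimes>\<^bsub>L\<^esub> \<iota> a \<in> \<iota> ` carrier R" if a: "a \<in> P l" for a
  proof -
    note aR = P_carrier[OF a]
    obtain b where b: "b \<in> carrier R" "cls s \<otimes>\<^bsub>L\<^esub> \<iota> a = \<iota> b"
      using s a unfolding conductor_def by blast
    \<comment> \<open>On representatives the scalar is moved out of the product by
      \<open>le_scale_left\<close> and then absorbed into \<open>R\<close> by
      \<open>le_base_smult\<close>.\<close>
    have "cls (Scale c s) \<otimes>\<^bsub>L\<^esub> \<iota> a = cls (Times (Scale c s) (Base a))"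
      using Scale.prems aR by (simp add: class_Times leavitt_map_def)
    also have "\<dots> = cls (Scale c (Times s (Base a)))"
      using Scale.prems aR by (intro class_eqI le_scale_left) auto
    also have "\<dots> = c \<odot>\<^bsub>L\<^esub> (cls s \<otimes>\<^bsub>L\<^esub> \<iota> a)"
      using Scale.prems aR by (simp add: class_Scale class_Times leavitt_map_def)
    also have "\<dots> = cls (Scale c (Base b))"
      using Scale.prems b by (simp add: class_Scale leavitt_map_def)
    also have "\<dots> = \<iota> (c \<odot>\<^bsub>R\<^esub> b)"
      using Scale.prems b unfolding leavitt_map_def
      by (intro class_eqI[OF le_base_smult, symmetric]) auto
    finally show ?thesis using Scale.prems b by auto
  qed
  then have "cls (Scale c s) \<in> conductor l" using Scale.prems by (simp add: conductor_def)
  then show ?case by blast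
qed

lemma induced_hom_kernel:
  assumes f: "f \<in> induced_homs K R n x" and "y \<in> conductor l" "f y = \<zero>\<^bsub>Q\<^esub>"
  shows "y = \<zero>\<^bsub>L\<^esub>"
proof -
  have "f \<in> ring_hom L Q" using f by (simp add: induced_homs_def alg_hom_def)
  then interpret f: ring_hom_ring L Q f by (intro ring_hom_ringI2 ring_L ring_Q)
  have f\<iota>: "f (\<iota> r) = qm r" if "r \<in> carrier R" for r using f that by (simp add: induced_homs_def)
  show ?thesis using assms(2,3)
  proof (induction l arbitrary: y)
    case 0
    \<comment> \<open>At level 0 the conductor condition for \<open>\<one>\<close> says that
      \<open>y\<close> itself comes from \<open>R\<close>.\<close>
    have "y \<otimes>\<^bsub>L\<^esub> \<iota> \<one>\<^bsub>R\<^esub> \<in> \<iota> ` carrier R" "y \<in> carrier L"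
      using 0(1) R.one_closed unfolding conductor_def P_0 by blast+
    then obtain r where "r \<in> carrier R" "y = \<iota> r" by (metis L.r_one \<iota>.hom_one imageE)
    then show ?case using 0(2) f\<iota> qm_kernel[of r] by simp
  next
    case (Suc l)
    have y: "y \<in> carrier L" using Suc.prems by (simp add: conductor_def)
    show ?case
    proof (rule L_annihilator[OF y], rule Suc.IH)
      fix i assume i: "i \<in> {1..n}"
      have xi: "\<iota> (x i) \<in> carrier L" using x_closed[OF i] by simp
      have "(y \<otimes>\<^bsub>L\<^esub> \<iota> (x i)) \<otimes>\<^bsub>L\<^esub> \<iota> a \<in> \<iota> ` carrier R" if a: "a \<in> P l" for a
      proof -
        have "(y \<otimes>\<^bsub>L\<^esub> \<iota> (x i)) \<otimes>\<^bsub>L\<^esub> \<iota> a = y \<otimes>\<^bsub>L\<^esub> \<iota> (x i \<otimes>\<^bsub>R\<^esub> a)"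
          using x_closed[OF i] P_carrier[OF a] y by (simp add: L.m_assoc)
        then show ?thesis using Suc.prems(1) x_mult_P[OF i a] by (simp add: conductor_def)
      qed
      then show "y \<otimes>\<^bsub>L\<^esub> \<iota> (x i) \<in> conductor l" using y xi by (simp add: conductor_def)
      show "f (y \<otimes>\<^bsub>L\<^esub> \<iota> (x i)) = \<zero>\<^bsub>Q\<^esub>" using y xi Suc.prems(2) by simp
    qed
  qed
qed

lemma induced_hom_inj:
  assumes f: "f \<in> induced_homs K R n x"
  shows "inj_on f (carrier L)"
proof -
  have "f \<in> ring_hom L Q" using f by (simp add: induced_homs_def alg_hom_def)
  then interpret f: ring_hom_ring L Q f by (intro ring_hom_ringI2 ring_L ring_Q)
  have "y = \<zero>\<^bsub>L\<^esub>" if y: "y \<in> carrier L" "f y = \<zero>\<^bsub>Q\<^esub>" for y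
  proof -
    obtain s where "wf s" "y = cls s" using y(1) by (rule carrier_LE)
    then obtain l where "y \<in> conductor l" using conductor_exhausts by auto
    then show ?thesis using y(2) by (rule induced_hom_kernel[OF f])
  qed
  then have "a_kernel L Q f = {\<zero>\<^bsub>L\<^esub>}"
    unfolding a_kernel_def' using f.hom_zero L.zero_closed by blast
  then show ?thesis by (rule f.trivial_ker_imp_inj)
qed

section \<open>Surjectivity, and the isomorphism with \<open>Q(R)\<close>\<close>

lemma induced_hom_surj:
  assumes f: "f \<in> induced_homs K R n x" and "partial_hom l \<phi>"
  shows "qc l \<phi> \<in> f ` carrier L"
  using assms(2)
proof (induction l arbitrary: \<phi>)
  case (0 \<phi>)
  \<comment> \<open>A right linear map on all of \<open>R\<close> is left multiplication by its
    value at one.\<close>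
  have "\<phi> a = \<phi> \<one>\<^bsub>R\<^esub> \<otimes>\<^bsub>R\<^esub> a" if "a \<in> P 0" for a
    using partial_hom_mult[OF 0, of "\<one>\<^bsub>R\<^esub>" a] that by simp
  then have "qc 0 \<phi> = qc 0 (\<lambda>a. \<phi> \<one>\<^bsub>R\<^esub> \<otimes>\<^bsub>R\<^esub> a)" by (rule quot_class_cong[OF 0])
  moreover have "\<phi> \<one>\<^bsub>R\<^esub> \<in> carrier R" using partial_hom_closed[OF 0] by simp
  ultimately have "qc 0 \<phi> = f (\<iota> (\<phi> \<one>\<^bsub>R\<^esub>))"
    using f by (simp add: induced_homs_def quotient_map_eq[of _ 0])
  then show ?case
    by (rule image_eqI) (rule \<iota>.hom_closed[OF \<open>\<phi> \<one>\<^bsub>R\<^esub> \<in> carrier R\<close>])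
next
  case (Suc l \<phi>)
  have f_hom: "f \<in> ring_hom L Q" using f by (simp add: induced_homs_def alg_hom_def)
  then interpret f: ring_hom_ring L Q f by (intro ring_hom_ringI2 ring_L ring_Q)
  let ?q = "qc (Suc l) \<phi>"
  have q: "?q \<in> carrier Q" using Suc.prems by simp
  have image: "?q \<otimes>\<^bsub>Q\<^esub> qm (x i) \<in> f ` carrier L" if i: "i \<in> {1..n}" for i
  proof -
    have hom: "partial_hom l (\<lambda>a. \<phi> (x i \<otimes>\<^bsub>R\<^esub> a))"
      using x_mult_P[OF i] x_closed[OF i] partial_hom_closed[OF Suc.prems]
        partial_hom_add[OF Suc.prems] partial_hom_mult[OF Suc.prems]
      by (auto simp: partial_hom_def R.r_distr P_carrier simp flip: R.m_assoc)
    have "?q \<otimes>\<^bsub>Q\<^esub> qm (x i) = qc (Suc l) (\<lambda>a. \<phi> (x i \<otimes>\<^bsub>R\<^esub> a))"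
      unfolding quotient_map_eq[OF x_closed[OF i], of 0]
      using quot_class_mult[OF Suc.prems partial_hom_left_mult[OF x_closed[OF i], of 0]] by simp
    \<comment> \<open>The product formula gives level \<open>Suc l\<close>, but by
      \<open>hom\<close> the same function is already defined on \<open>P l\<close>; this drop is
      what the induction uses.\<close>
    also have "\<dots> = qc l (\<lambda>a. \<phi> (x i \<otimes>\<^bsub>R\<^esub> a))"
      using quot_class_mono[OF hom, of "Suc l"] by simp
    finally show ?thesis using Suc.IH[OF hom] by simp
  qed
  \<comment> \<open>Preimages of the products \<open>?q x i\<close>. The sum of the
    \<open>y i \<otimes> star i\<close> is then a preimage of \<open>?q\<close>, by expansion along
    the inverse column in \<open>Q\<close>.\<close>
  define y where "y i = inv_into (carrier L) f (?q \<otimes>\<^bsub>Q\<^esub> qm (x i))" for i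
  have y: "y i \<in> carrier L" "f (y i) = ?q \<otimes>\<^bsub>Q\<^esub> qm (x i)" if "i \<in> {1..n}" for i
    unfolding y_def by (rule inv_into_into[OF image[OF that]], rule f_inv_into_f[OF image[OF that]])
  have y_star: "(\<lambda>i. y i \<otimes>\<^bsub>L\<^esub> star i) \<in> {1..n} \<rightarrow> carrier L"
    using y star_funcset by (auto simp: Pi_iff)
  have "f (\<Oplus>\<^bsub>L\<^esub>i\<in>{1..n}. y i \<otimes>\<^bsub>L\<^esub> star i) = (\<Oplus>\<^bsub>Q\<^esub>i\<in>{1..n}. f (y i \<otimes>\<^bsub>L\<^esub> star i))"
    by (rule ring_hom_finsum[OF ring_L ring_Q f_hom _ y_star]) simp
  also have "\<dots> = (\<Oplus>\<^bsub>Q\<^esub>i\<in>{1..n}. (?q \<otimes>\<^bsub>Q\<^esub> qm (x i)) \<otimes>\<^bsub>Q\<^esub> qstar i)"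
  proof (rule Q.finsum_cong')
    fix i assume i: "i \<in> {1..n}"
    then show "f (y i \<otimes>\<^bsub>L\<^esub> star i) = (?q \<otimes>\<^bsub>Q\<^esub> qm (x i)) \<otimes>\<^bsub>Q\<^esub> qstar i"
      using y[OF i] funcset_mem[OF star_funcset i] f by (simp add: induced_homs_def)
  qed (use q qstar_funcset x_closed in \<open>auto simp: Pi_iff\<close>)
  also have "\<dots> = ?q"
    by (rule Q.dual_row_expand[OF _ qm_x_funcset qstar_funcset qm_x_qstar_sum q, symmetric]) simp
  finally have "?q = f (\<Oplus>\<^bsub>L\<^esub>i\<in>{1..n}. y i \<otimes>\<^bsub>L\<^esub> star i)" by simp
  then show ?case by (rule image_eqI) (rule L.finsum_closed[OF y_star])
qed

theorem induced_hom_iso: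
  assumes f: "f \<in> induced_homs K R n x"
  shows "f \<in> alg_iso K L Q"
proof -
  have hom: "f \<in> alg_hom K L Q" using f by (simp add: induced_homs_def)
  then have "f ` carrier L \<subseteq> carrier Q" by (auto simp: alg_hom_def ring_hom_def)
  moreover have "carrier Q \<subseteq> f ` carrier L"
    using induced_hom_surj[OF f] by (auto elim!: carrier_QE)
  ultimately show ?thesis
    using hom induced_hom_inj[OF f] by (auto simp: alg_iso_def bij_betw_def)
qed

text \<open>Composed with the induced homomorphism, \<open>\<iota>\<close> becomes the canonical map
  into \<open>Q(R)\<close>, whose kernel is trivial by \<open>qm_kernel\<close>.\<close>

theorem \<iota>_inj: "inj_on \<iota> (carrier R)"
proof -
  obtain f where "f \<in> induced_homs K R n x" using induced_hom_unique by blast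
  then have f\<iota>: "(f \<circ> \<iota>) r = qm r" if "r \<in> carrier R" for r
    using that by (simp add: induced_homs_def)
  have "a_kernel R Q qm = {\<zero>\<^bsub>R\<^esub>}"
    unfolding a_kernel_def' using qm_kernel qm.hom_zero R.zero_closed by blast
  then have "inj_on qm (carrier R)" by (rule qm.trivial_ker_imp_inj)
  then have "inj_on (f \<circ> \<iota>) (carrier R)" by (simp add: inj_on_def f\<iota>[unfolded o_apply])
  then show ?thesis by (rule inj_on_imageI2)
qed

end

theorem theorem5p1:
  fixes K :: "('k, 's) ring_scheme" and R :: "('k, 'a, 't) module_scheme"
    and n :: nat and x :: "nat \<Rightarrow> 'a"
  assumes "assoc_algebra K R"
    and "n \<ge> 2"
    and "\<And>i. i \<in> {1..n} \<Longrightarrow> x i \<in> carrier R"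
  defines "\<iota> \<equiv> leavitt_map K R n x"
    and "I \<equiv> right_span R n x"
    and "L \<equiv> leavitt_algebra K R n x"
    and "S \<equiv> leavitt_image K R n x"
    and "Q \<equiv> quotient_algebra R (right_span R n x)"
  shows
    "(free_right_module_on S n (\<lambda>i. \<iota> (x i)) (right_span S n (\<lambda>i. \<iota> (x i))) \<and>
      trivial_left_annihilator S (right_span S n (\<lambda>i. \<iota> (x i))) \<and>
      (inj_on \<iota> (carrier R) \<longrightarrow>
         internal_direct_sum R n (\<lambda>i. {x i \<otimes>\<^bsub>R\<^esub> r |r. r \<in> carrier R}) I \<and>
         free_right_module_on R n x I \<and>
         trivial_left_annihilator R I)) \<and>
     (ideal I R \<and> free_right_module_on R n x I \<and> trivial_left_annihilator R I \<longrightarrow>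
        gabriel_topology R (adic_topology R I) \<and>
        (\<exists>!f. f \<in> induced_homs K R n x) \<and>
        (\<forall>f\<in>induced_homs K R n x. f \<in> alg_iso K L Q) \<and>
        inj_on \<iota> (carrier R))"
proof -
  interpret row: leavitt_row K R n x
    using assms(1,3) by (rule leavitt_row.intro)
  have part1: "internal_direct_sum R n (\<lambda>i. {x i \<otimes>\<^bsub>R\<^esub> r |r. r \<in> carrier R}) I \<and>
         free_right_module_on R n x I \<and> trivial_left_annihilator R I" if "inj_on \<iota> (carrier R)"
    using that row.inj_imp_free row.inj_imp_annihilator
      row.R.free_imp_internal_direct_sum[OF row.x_funcset]
    unfolding \<iota>_def I_def by blast
  have part2: "gabriel_topology R (adic_topology R I) \<and> (\<exists>!f. f \<in> induced_homs K R n x) \<and>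
        (\<forall>f\<in>induced_homs K R n x. f \<in> alg_iso K L Q) \<and> inj_on \<iota> (carrier R)"
    if "ideal I R \<and> free_right_module_on R n x I \<and> trivial_left_annihilator R I"
  proof -
    \<comment> \<open>The premise of part (2) supplies exactly the assumptions that this locale adds
      to \<open>leavitt_row\<close>.\<close>
    interpret leavitt_free K R n x
      using that unfolding I_def
      by (intro leavitt_free.intro leavitt_free_axioms.intro row.leavitt_row_axioms) simp_all
    show ?thesis
      unfolding \<iota>_def I_def L_def Q_def
      using gabriel_adic induced_hom_unique induced_hom_iso \<iota>_inj by blast
  qed
  show ?thesis
    unfolding S_def \<iota>_def
    using row.\<iota>_x_free row.\<iota>_x_annihilator part1 part2 unfolding \<iota>_def by blast
qed

end
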